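(* The map $X=(U_0^\wedge\times\Lambda)/\!\sim\ \to\ \overline{X}=(U_0^\wedge\times\overline{\Lambda})/\!\sim$ induced by the inclusion $\Lambda\hookrightarrow\overline{\Lambda}$ is injective and identifies the Bruhat-Tits building $X$ of $PGL(V)$ with an open, dense subset of $\overline{X}$. Moreover, there is a well-defined action of $G$ on $\overline{X}$ given as follows: for $g\in G$ and $(v,x)\in U_0^\wedge\times\overline{\Lambda}$ write $gv=unh$ with $u\in U_0^\wedge$, $n\in N$, $h\in P_x$ (which is always possible), and let $g$ map the class of $(v,x)$ to the class of $(u,\nu(n)x)$. This action is compatible with the action of $G$ on $X$.
   Context: Setting. $K$ is a finite extension of $\mathbb{Q}_p$ with valuation $v$ normalized so that a prime element $\pi$ has $v(\pi)=1$ (and $v(0)=\infty$); $V$ is an $n$-dimensional $K$-vector space with fixed basis $v_1,\dots,v_n$; $\underline{n}=\{1,\dots,n\}$. $G=PGL(V)$ denotes the group of $K$-rational points, with its $p$-adic topology. $T\subseteq G$ is the image of the diagonal matrices, $N\subseteq G$ is its normalizer, i.e. the image of the monomial matrices; $N=T\rtimes W$ with $W$ the group of permutation matrices, $w(v_i)=v_{w(i)}$. $\Lambda=X_*(T)\otimes\mathbb{R}=\sum_{i=1}^n\mathbb{R}\eta_i$ subject to the single relation $\sum_i\eta_i=0$ ($\eta_i$ is the cocharacter induced by $x\mapsto$ diagonal matrix with $x$ at place $i$ and $1$ elsewhere). Roots: $\Phi=\{a_{ij}:i\neq j\}$, $a_{ij}(\sum x_k\eta_k)=x_i-x_j$. Compactified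 apartment. For nonempty $I\subseteq\underline{n}$ let $\Lambda_I=\sum_{i\in I}\mathbb{R}\eta_i^I$ with the single relation $\sum_{i\in I}\eta_i^I=0$, and $r_I:\Lambda\to\Lambda_I$, $r_I(\sum_{i=1}^n x_i\eta_i)=\sum_{i\in I}x_i\eta_i^I$; $\Lambda_{\underline{n}}=\Lambda$. $\overline{\Lambda}$ is the disjoint union $\bigcup_{\emptyset\ne I\subseteq\underline{n}}\Lambda_I$, with topology having as base the open subsets of $\Lambda$ together with the sets $C_U^I=(U+D_I)\cup\bigcup_{I\subseteq J\subsetneq\underline{n}}r_J(U+D_I)$ for nonempty $I\subsetneq\underline{n}$ and bounded open $U\subseteq\Lambda$, where $D_I=\sum_{i\notin I}\mathbb{R}_{\ge0}(-\eta_i)$. $N$ acts on $\overline{\Lambda}$ via $\nu$: $w\in W$ maps $\Lambda_I$ to $\Lambda_{w(I)}$ linearly by $\eta_i^I\mapsto\eta_{w(i)}^{w(I)}$, and $t\in T$ induced by $\mathrm{diag}(t_1,\dots,t_n)$ acts on $\Lambda_I$ by translation by $-\sum_{i\in I}v(t_i)\eta_i^I$. Groups. For $a=a_{ij}$, $U_a\subseteq G$ is the image of the group of unipotent matrices $v_j\mapsto v_j+\omega v_i$, $v_l\mapsto v_l$ ($l\ne j$), $\omega\in K$; $\psi_a(u)=v(\omega)$. For $x\in\overline{\Lambda}$, $f_x(a)=\inf\{t\in\mathbb{R}: x\in\overline{\{z\in\Lambda:a(z)\ge -t\}}\}$ (closure in $\overline{\Lambda}$; $\inf\emptyset=\infty$,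 $\inf\mathbb{R}=-\infty$), $U_{a,x}=\{u\in U_a:\psi_a(u)\ge f_x(a)\}$ (so it is $\{1\}$ if $f_x(a)=\infty$ and $U_a$ if $f_x(a)=-\infty$), $U_x$ is the subgroup generated by all $U_{a,x}$, $a\in\Phi$; $N_x=\{n\in N:\nu(n)x=x\}$; $P_x=U_xN_x$ (a group). $Z=\ker(\nu|_T:T\to\Lambda)$ (the elements of $T$ acting trivially on $\Lambda$), $U_0^\wedge=U_0Z$, where $U_0=U_x$ for $x=0\in\Lambda$; it is a compact subgroup of $G$. Equivalence relation: $(g,x)\sim(h,y)$ iff there is $n\in N$ with $\nu(n)x=y$ and $g^{-1}hn\in P_x$. $\overline{X}=(U_0^\wedge\times\overline{\Lambda})/\!\sim$ with the quotient topology. The building is $X=(G\times\Lambda)/\!\sim$ with $G$ acting by left multiplication on the first factor; the inclusion $U_0^\wedge\times\Lambda\hookrightarrow G\times\Lambda$ induces a bijection $(U_0^\wedge\times\Lambda)/\!\sim\ \to X$, a homeomorphism for the quotient topology on the left, by which the two are identified. *)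

theory Defs
  imports
    "HOL-Analysis.Analysis"
    "HOL-Computational_Algebra.Primes"
    "HOL-Algebra.Group_Action"
    "HOL-Algebra.Generated_Groups"
begin

text \<open>
  The vector space \<open>V\<close> is \<open>K\<^sup>n\<close> with its standard basis, indexed by a finite type \<open>'n\<close>.
  Elements of \<open>PGL(V)\<close> are cosets of scalar matrices, hence sets of matrices.
\<close>

type_synonym ('k, 'n) pgl = "('k^'n^'n) set"


section \<open>Finite extensions of the p-adic numbers\<close>

definition rat_padic_val :: "nat \<Rightarrow> rat \<Rightarrow> int" where
  "rat_padic_val p q =
     int (multiplicity (int p) (fst (quotient_of q))) - int (multiplicity (int p) (snd (quotient_of q)))"

definition normalized_valuation :: "('k::field \<Rightarrow> ereal) \<Rightarrow> bool" where
  "normalized_valuation v \<longleftrightarrow>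
     (\<forall>x. v x = \<infinity> \<longleftrightarrow> x = 0) \<and>
     (\<forall>x. x \<noteq> 0 \<longrightarrow> (\<exists>m::int. v x = ereal (of_int m))) \<and>
     (\<forall>x y. v (x * y) = v x + v y) \<and>
     (\<forall>x y. min (v x) (v y) \<le> v (x + y)) \<and>
     (\<exists>\<pi>. v \<pi> = 1)"

text \<open>
  \<open>\<rat>\<^sub>p\<close> is the completion of the rationals for the p-adic valuation. The subfield \<open>F\<close> of \<open>K\<close>
  is such a completion when \<open>v\<close> restricts to a positive multiple of the p-adic valuation
  on the rationals (the multiple is the ramification index, as \<open>v\<close> is normalized on \<open>K\<close>),
  the rationals are dense in \<open>F\<close>, and \<open>F\<close> is complete.
\<close>

definition is_padic_subfield :: "nat \<Rightarrow> ('k::field_char_0 \<Rightarrow> ereal) \<Rightarrow> 'k set \<Rightarrow> bool" where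
  "is_padic_subfield p v F \<longleftrightarrow>
     1 \<in> F \<and> (\<forall>x\<in>F. \<forall>y\<in>F. x - y \<in> F \<and> x * y \<in> F) \<and> (\<forall>x\<in>F. inverse x \<in> F) \<and>
     (\<exists>e::real. 0 < e \<and> (\<forall>q. q \<noteq> 0 \<longrightarrow> v (of_rat q) = ereal (e * of_int (rat_padic_val p q)))) \<and>
     (\<forall>x\<in>F. \<forall>r::real. \<exists>q. ereal r < v (x - of_rat q)) \<and>
     (\<forall>s::nat \<Rightarrow> 'k. range s \<subseteq> F \<and> (\<forall>r::real. \<exists>M. \<forall>m\<ge>M. \<forall>l\<ge>M. ereal r < v (s m - s l)) \<longrightarrow>
        (\<exists>x\<in>F. \<forall>r::real. \<exists>M. \<forall>m\<ge>M. ereal r < v (s m - x)))"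

definition finite_extension_of_Qp :: "nat \<Rightarrow> ('k::field_char_0 \<Rightarrow> ereal) \<Rightarrow> bool" where
  "finite_extension_of_Qp p v \<longleftrightarrow>
     prime p \<and> normalized_valuation v \<and>
     (\<exists>F. is_padic_subfield p v F \<and>
        (\<exists>B. finite B \<and> (\<forall>x. \<exists>c. c ` B \<subseteq> F \<and> x = (\<Sum>b\<in>B. c b * b))))"


section \<open>Quotient topologies\<close>

definition final_topology :: "'b set \<Rightarrow> 'a topology \<Rightarrow> ('a \<Rightarrow> 'b) \<Rightarrow> 'b topology" where
  "final_topology Y X f = topology (\<lambda>S. S \<subseteq> Y \<and> openin X {x \<in> topspace X. f x \<in> S})"

lemma openin_final_topology:
  "openin (final_topology Y X f) S \<longleftrightarrow> S \<subseteq> Y \<and> openin X {x \<in> topspace X. f x \<in> S}"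
proof -
  have "istopology (\<lambda>S. S \<subseteq> Y \<and> openin X {x \<in> topspace X. f x \<in> S})"
    unfolding istopology_def
  proof (intro conjI allI impI)
    fix S T
    assume *: "S \<subseteq> Y \<and> openin X {x \<in> topspace X. f x \<in> S}"
      "T \<subseteq> Y \<and> openin X {x \<in> topspace X. f x \<in> T}"
    have "{x \<in> topspace X. f x \<in> S \<inter> T} =
        {x \<in> topspace X. f x \<in> S} \<inter> {x \<in> topspace X. f x \<in> T}"
      by blast
    then show "openin X {x \<in> topspace X. f x \<in> S \<inter> T}"
      using * by (simp only: openin_Int)
    show "S \<inter> T \<subseteq> Y"
      using * by blast
  next
    fix \<K>
    assume *: "\<forall>K\<in>\<K>. K \<subseteq> Y \<and> openin X {x \<in> topspace X. f x \<in> K}"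
    have "{x \<in> topspace X. f x \<in> \<Union> \<K>} = \<Union> ((\<lambda>K. {x \<in> topspace X. f x \<in> K}) ` \<K>)"
      by blast
    moreover have "openin X (\<Union> ((\<lambda>K. {x \<in> topspace X. f x \<in> K}) ` \<K>))"
      using * by (intro openin_Union) blast
    ultimately show "openin X {x \<in> topspace X. f x \<in> \<Union> \<K>}"
      by (rule ssubst)
    show "\<Union> \<K> \<subseteq> Y"
      using * by (intro Union_least) blast
  qed
  then show ?thesis
    unfolding final_topology_def by (simp only: topology_inverse')
qed


section \<open>The topological group PGL(V)\<close>

definition GL_group :: "('k::field^'n::finite^'n) monoid" where
  "GL_group = \<lparr>carrier = {A. invertible A}, mult = matrix_matrix_mult, one = mat 1\<rparr>"

definition scalar_matrices :: "('k::field^'n::finite^'n) set" where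
  "scalar_matrices = {mat c | c. c \<noteq> 0}"

definition PGL :: "('k::field, 'n::finite) pgl monoid" where
  "PGL = GL_group Mod scalar_matrices"

definition to_PGL :: "'k::field^'n^'n \<Rightarrow> ('k, 'n::finite) pgl" where
  "to_PGL A = scalar_matrices #>\<^bsub>GL_group\<^esub> A"

definition padic_matrix_topology :: "('k::field \<Rightarrow> ereal) \<Rightarrow> ('k^'n::finite^'n) topology" where
  "padic_matrix_topology v = topology (\<lambda>S. \<forall>A\<in>S. \<exists>r::real. \<forall>B.
     (\<forall>i j. ereal r < v (B $ i $ j - A $ i $ j)) \<longrightarrow> B \<in> S)"

definition PGL_topology :: "('k::field \<Rightarrow> ereal) \<Rightarrow> ('k, 'n::finite) pgl topology" where
  "PGL_topology v = final_topology (carrier PGL)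
     (subtopology (padic_matrix_topology v) (carrier GL_group)) to_PGL"

definition diagonal_matrix :: "('n::finite \<Rightarrow> 'k::field) \<Rightarrow> 'k^'n^'n" where
  "diagonal_matrix t = (\<chi> i j. if i = j then t i else 0)"

definition permutation_matrix :: "('n::finite \<Rightarrow> 'n) \<Rightarrow> 'k::field^'n^'n" where
  "permutation_matrix w = (\<chi> i j. if i = w j then 1 else 0)"

definition torus :: "('k::field, 'n::finite) pgl set" where
  "torus = {to_PGL (diagonal_matrix t) | t. \<forall>i. t i \<noteq> 0}"

definition monomial_group :: "('k::field, 'n::finite) pgl set" where
  "monomial_group = {to_PGL (diagonal_matrix t ** permutation_matrix w) | t w.
     (\<forall>i. t i \<noteq> 0) \<and> bij w}"


section \<open>The compactified apartment\<close>

text \<open>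
  The point \<open>\<Sum>\<^sub>i\<^sub>\<in>\<^sub>I x\<^sub>i \<eta>\<^sub>i\<^sup>I\<close> of \<open>\<Lambda>\<^sub>I\<close> is encoded as the index set \<open>I\<close> (which makes the union over
  \<open>I\<close> disjoint) together with its coset in \<open>\<real>\<^sup>n\<close>: the coordinates outside \<open>I\<close> are arbitrary
  and those in \<open>I\<close> are determined up to a common summand.
\<close>

type_synonym 'n apt_point = "'n set \<times> (real^'n) set"

definition apt_pt :: "'n::finite set \<Rightarrow> real^'n \<Rightarrow> 'n apt_point" where
  "apt_pt I x = (I, {y. \<exists>c. \<forall>i\<in>I. y $ i = x $ i + c})"

definition stratum :: "'n::finite set \<Rightarrow> 'n apt_point set" where
  "stratum I = range (apt_pt I)"

abbreviation apartment :: "'n::finite apt_point set" where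
  "apartment \<equiv> stratum UNIV"

definition compact_apartment :: "'n::finite apt_point set" where
  "compact_apartment = (\<Union>I\<in>{I. I \<noteq> {}}. stratum I)"

definition stratum_map :: "'n::finite set \<Rightarrow> 'n apt_point \<Rightarrow> 'n apt_point" where
  "stratum_map J P = (J, {y. \<exists>x\<in>snd P. \<exists>c. \<forall>i\<in>J. y $ i = x $ i + c})"

lemma stratum_map_apt_pt: "stratum_map J (apt_pt UNIV x) = apt_pt J x"
proof -
  have "(\<exists>z. (\<exists>c. \<forall>i. z $ i = x $ i + c) \<and> (\<exists>c. \<forall>i\<in>J. y $ i = z $ i + c)) \<longleftrightarrow>
      (\<exists>c. \<forall>i\<in>J. y $ i = x $ i + c)" for y :: "real^'a"
  proof
    assume "\<exists>z. (\<exists>c. \<forall>i. z $ i = x $ i + c) \<and> (\<exists>c. \<forall>i\<in>J. y $ i = z $ i + c)"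
    then obtain z c d where "\<forall>i. z $ i = x $ i + c" "\<forall>i\<in>J. y $ i = z $ i + d"
      by blast
    then have "\<forall>i\<in>J. y $ i = x $ i + (c + d)"
      by simp
    then show "\<exists>c. \<forall>i\<in>J. y $ i = x $ i + c"
      by blast
  next
    assume "\<exists>c. \<forall>i\<in>J. y $ i = x $ i + c"
    moreover have "\<forall>i. x $ i = x $ i + 0"
      by simp
    ultimately show "\<exists>z. (\<exists>c. \<forall>i. z $ i = x $ i + c) \<and> (\<exists>c. \<forall>i\<in>J. y $ i = z $ i + c)"
      by blast
  qed
  note eq = this
  show ?thesis
    unfolding stratum_map_def apt_pt_def snd_conv Bex_def mem_Collect_eq ball_UNIV
    by (simp only: eq)
qed

definition apartment_topology :: "'n::finite apt_point topology" where
  "apartment_topology = final_topology apartment euclidean (apt_pt UNIV)"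

definition bounded_in_apartment :: "'n::finite apt_point set \<Rightarrow> bool" where
  "bounded_in_apartment U \<longleftrightarrow> (\<exists>B. bounded B \<and> U \<subseteq> apt_pt UNIV ` B)"

text \<open>\<open>plus_cone U I\<close> is \<open>U + D\<^sub>I\<close>.\<close>

definition plus_cone :: "'n::finite apt_point set \<Rightarrow> 'n set \<Rightarrow> 'n apt_point set" where
  "plus_cone U I = {apt_pt UNIV (x + d) | x d.
     apt_pt UNIV x \<in> U \<and> (\<forall>i\<in>I. d $ i = 0) \<and> (\<forall>i. i \<notin> I \<longrightarrow> d $ i \<le> 0)}"

definition corner_nhd :: "'n::finite set \<Rightarrow> 'n apt_point set \<Rightarrow> 'n apt_point set" where
  "corner_nhd I U =
     plus_cone U I \<union> (\<Union>J\<in>{J. I \<subseteq> J \<and> J \<subset> UNIV}. stratum_map J ` plus_cone U I)"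

definition compact_apartment_topology :: "'n::finite apt_point topology" where
  "compact_apartment_topology = topology_generated_by
     ({U. openin apartment_topology U} \<union>
      {corner_nhd I U | I U. I \<noteq> {} \<and> I \<noteq> UNIV \<and> openin apartment_topology U \<and> bounded_in_apartment U})"

definition perm_act :: "('n::finite \<Rightarrow> 'n) \<Rightarrow> 'n apt_point \<Rightarrow> 'n apt_point" where
  "perm_act w P = (w ` fst P, (\<lambda>y. \<chi> i. y $ (inv_into UNIV w i)) ` snd P)"

definition torus_act :: "('k \<Rightarrow> ereal) \<Rightarrow> ('n::finite \<Rightarrow> 'k) \<Rightarrow> 'n apt_point \<Rightarrow> 'n apt_point" where
  "torus_act v t P = (fst P, (\<lambda>y. \<chi> i. y $ i - real_of_ereal (v (t i))) ` snd P)"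

text \<open>
  The action of \<open>N = T \<rtimes> W\<close>. The result does not depend on the diagonal matrix representing
  the element of \<open>T\<close>, as a scalar matrix translates by a multiple of \<open>\<Sum>\<^sub>i\<^sub>\<in>\<^sub>I \<eta>\<^sub>i\<^sup>I = 0\<close>.
\<close>

definition nu :: "('k::field \<Rightarrow> ereal) \<Rightarrow> ('k, 'n::finite) pgl \<Rightarrow> 'n apt_point \<Rightarrow> 'n apt_point" where
  "nu v g P = (THE Q. \<exists>t w. (\<forall>i. t i \<noteq> 0) \<and> bij w \<and>
     g = to_PGL (diagonal_matrix t ** permutation_matrix w) \<and> Q = torus_act v t (perm_act w P))"


section \<open>The stabilizer groups\<close>

definition root_halfspace :: "'n::finite \<Rightarrow> 'n \<Rightarrow> real \<Rightarrow> 'n apt_point set" where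
  "root_halfspace i j s = apt_pt UNIV ` {z. z $ i - z $ j \<ge> s}"

definition root_bound :: "'n::finite apt_point \<Rightarrow> 'n \<Rightarrow> 'n \<Rightarrow> ereal" where
  "root_bound x i j = Inf {ereal t | t.
     x \<in> compact_apartment_topology closure_of root_halfspace i j (- t)}"

definition root_matrix :: "'n::finite \<Rightarrow> 'n \<Rightarrow> 'k::field \<Rightarrow> 'k^'n^'n" where
  "root_matrix i j \<omega> = (\<chi> k l. if k = l then 1 else if k = i \<and> l = j then \<omega> else 0)"

definition root_subgroup ::
    "('k::field \<Rightarrow> ereal) \<Rightarrow> 'n apt_point \<Rightarrow> 'n \<Rightarrow> 'n \<Rightarrow> ('k, 'n::finite) pgl set" where
  "root_subgroup v x i j = {to_PGL (root_matrix i j \<omega>) | \<omega>. v \<omega> \<ge> root_bound x i j}"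

definition U_stab :: "('k::field \<Rightarrow> ereal) \<Rightarrow> 'n apt_point \<Rightarrow> ('k, 'n::finite) pgl set" where
  "U_stab v x = generate PGL (\<Union>(i, j)\<in>{(i, j). i \<noteq> j}. root_subgroup v x i j)"

definition N_stab :: "('k::field \<Rightarrow> ereal) \<Rightarrow> 'n apt_point \<Rightarrow> ('k, 'n::finite) pgl set" where
  "N_stab v x = {n \<in> monomial_group. nu v n x = x}"

definition P_stab :: "('k::field \<Rightarrow> ereal) \<Rightarrow> 'n apt_point \<Rightarrow> ('k, 'n::finite) pgl set" where
  "P_stab v x = U_stab v x <#>\<^bsub>PGL\<^esub> N_stab v x"

definition torus_kernel :: "('k::field \<Rightarrow> ereal) \<Rightarrow> ('k, 'n::finite) pgl set" where
  "torus_kernel v = {t \<in> torus. \<forall>x\<in>apartment. nu v t x = x}"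

definition U0_hat :: "('k::field \<Rightarrow> ereal) \<Rightarrow> ('k, 'n::finite) pgl set" where
  "U0_hat v = U_stab v (apt_pt UNIV 0) <#>\<^bsub>PGL\<^esub> torus_kernel v"


section \<open>The building and its compactification\<close>

type_synonym ('k, 'n) chart_pt = "('k, 'n) pgl \<times> 'n apt_point"

definition glue_rel ::
    "('k::field \<Rightarrow> ereal) \<Rightarrow> ('k, 'n::finite) chart_pt set \<Rightarrow> ('k, 'n) chart_pt rel" where
  "glue_rel v D = {((g, x), (h, y)) | g x h y. (g, x) \<in> D \<and> (h, y) \<in> D \<and>
     (\<exists>n\<in>monomial_group. nu v n x = y \<and> inv\<^bsub>PGL\<^esub> g \<otimes>\<^bsub>PGL\<^esub> h \<otimes>\<^bsub>PGL\<^esub> n \<in> P_stab v x)}"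

abbreviation building_rel :: "('k::field \<Rightarrow> ereal) \<Rightarrow> ('k, 'n::finite) chart_pt rel" where
  "building_rel v \<equiv> glue_rel v (carrier PGL \<times> apartment)"

abbreviation compact_rel :: "('k::field \<Rightarrow> ereal) \<Rightarrow> ('k, 'n::finite) chart_pt rel" where
  "compact_rel v \<equiv> glue_rel v (U0_hat v \<times> compact_apartment)"

definition building :: "('k::field \<Rightarrow> ereal) \<Rightarrow> ('k, 'n::finite) chart_pt set set" where
  "building v = (carrier PGL \<times> apartment) // building_rel v"

definition building_class ::
    "('k::field \<Rightarrow> ereal) \<Rightarrow> ('k, 'n::finite) chart_pt \<Rightarrow> ('k, 'n) chart_pt set" where
  "building_class v a = building_rel v `` {a}"

text \<open>
  The building carries the quotient topology of \<open>U\<^sub>0\<^sup>\<and> \<times> \<Lambda>\<close> along \<open>(u, x) \<mapsto> [(u, x)]\<close>; this is the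
  identification of \<open>(U\<^sub>0\<^sup>\<and> \<times> \<Lambda>)/\<sim>\<close> with \<open>(G \<times> \<Lambda>)/\<sim>\<close>.
\<close>

definition building_topology ::
    "('k::field \<Rightarrow> ereal) \<Rightarrow> ('k, 'n::finite) chart_pt set topology" where
  "building_topology v = final_topology (building v)
     (prod_topology (subtopology (PGL_topology v) (U0_hat v)) apartment_topology)
     (building_class v)"

text \<open>As \<open>\<sim>\<close> is invariant under left multiplication, the image of a class is a class.\<close>

definition building_act :: "('k::field, 'n::finite) pgl \<Rightarrow> ('k, 'n) chart_pt set \<Rightarrow> ('k, 'n) chart_pt set" where
  "building_act g c = (\<lambda>(h, x). (g \<otimes>\<^bsub>PGL\<^esub> h, x)) ` c"

definition compact_building :: "('k::field \<Rightarrow> ereal) \<Rightarrow> ('k, 'n::finite) chart_pt set set" where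
  "compact_building v = (U0_hat v \<times> compact_apartment) // compact_rel v"

definition compact_class ::
    "('k::field \<Rightarrow> ereal) \<Rightarrow> ('k, 'n::finite) chart_pt \<Rightarrow> ('k, 'n) chart_pt set" where
  "compact_class v a = compact_rel v `` {a}"

definition compact_building_topology ::
    "('k::field \<Rightarrow> ereal) \<Rightarrow> ('k, 'n::finite) chart_pt set topology" where
  "compact_building_topology v = final_topology (compact_building v)
     (prod_topology (subtopology (PGL_topology v) (U0_hat v)) compact_apartment_topology)
     (compact_class v)"

text \<open>
  The map induced by the inclusion of \<open>\<Lambda>\<close>: a class is sent to the set of all points equivalent
  to one of its representatives in \<open>U\<^sub>0\<^sup>\<and> \<times> \<Lambda>\<close>.
\<close>

definition building_incl ::
    "('k::field \<Rightarrow> ereal) \<Rightarrow> ('k, 'n::finite) chart_pt set \<Rightarrow> ('k, 'n) chart_pt set" where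
  "building_incl v c = compact_rel v `` c"

end

theory Submission
  imports Defs
begin

text \<open>
  Nothing but the following is needed about the relation \<open>\<sim>\<close>: the groups \<open>P\<^sub>x\<close> satisfy
  \<open>n P\<^sub>x n\<inverse> = P\<^bsub>\<nu>(n)x\<^esub>\<close>, so that \<open>\<sim>\<close> is an equivalence relation on all of \<open>G \<times> \<Lambda>\<close>-bar, and
  \<open>G = U\<^sub>0\<^sup>\<and> N P\<^sub>x\<close>, so that every class meets \<open>U\<^sub>0\<^sup>\<and> \<times> \<Lambda>\<close>-bar. Hence \<open>X\<close>-bar is the quotient of
  \<open>G \<times> \<Lambda>\<close>-bar, on which \<open>G\<close> acts by left multiplication. The conjugation rule follows from the
  explicit form of \<open>f\<^sub>x\<close> on each stratum, the decomposition from Gaussian elimination with a pivot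
  that is minimal for the valuation weighted by \<open>x\<close>. Finally \<open>\<Lambda>\<close> is open, dense and stable under
  \<open>N\<close>, so \<open>U\<^sub>0\<^sup>\<and> \<times> \<Lambda>\<close> is an open, dense, saturated subset of \<open>U\<^sub>0\<^sup>\<and> \<times> \<Lambda>\<close>-bar.
\<close>

section \<open>Gluing along a group action\<close>

text \<open>Left multiplication by g leaves U_0^, so it cannot be defined on the chart that X-bar is
  a quotient of. Traces on this chart of classes in G x Lambda-bar remove the obstacle: a trace is
  never empty, hence determines its class, and (unh, x) ~ (u, nu(n)x) turns the recipe for the
  action into [gv, x] = [u, nu(n)x], whose left side does not mention u, n, h. The argument is
  formal and is carried out for a group with a subgroup N acting on a set E and subgroups
  \<open>P x\<close>; K plays the part of U_0^.

  The pivot weight comes from f_x(a_ij) = x_j - x_i for i, j in I: the resulting bound on v(-A_kj /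
  A_ki) says that v(A_ki) - x_i <= v(A_kj) - x_j. The infinite values dictate the order of the
  columns. For j outside I the bound is -infinity, so clearing column j is always allowed; for j in
  I and i outside I it is +infinity, so a pivot outside I must have nothing to clear in the columns
  of I.\<close>

locale gluing = group G for G (structure) +
  fixes N :: "'a set" and nu :: "'a \<Rightarrow> 'b \<Rightarrow> 'b" and E :: "'b set" and P :: "'b \<Rightarrow> 'a set" and K :: "'a set"
  assumes subgroup_N: "subgroup N G"
    and nu_closed: "\<lbrakk>n \<in> N; x \<in> E\<rbrakk> \<Longrightarrow> nu n x \<in> E"
    and nu_one: "x \<in> E \<Longrightarrow> nu \<one> x = x"
    and nu_mult: "\<lbrakk>m \<in> N; n \<in> N; x \<in> E\<rbrakk> \<Longrightarrow> nu (m \<otimes> n) x = nu m (nu n x)"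
    and subgroup_P: "x \<in> E \<Longrightarrow> subgroup (P x) G"
    and conj_P: "\<lbrakk>n \<in> N; x \<in> E; h \<in> P x\<rbrakk> \<Longrightarrow> n \<otimes> h \<otimes> inv n \<in> P (nu n x)"
    and K_carrier: "K \<subseteq> carrier G"
    and decomposition: "\<lbrakk>g \<in> carrier G; x \<in> E\<rbrakk> \<Longrightarrow> \<exists>u\<in>K. \<exists>n\<in>N. \<exists>h\<in>P x. g = u \<otimes> n \<otimes> h"
begin

lemma inv_mult_cancel: "\<lbrakk>a \<in> carrier G; b \<in> carrier G\<rbrakk> \<Longrightarrow> inv a \<otimes> (a \<otimes> b) = b"
  by (simp add: m_assoc[symmetric])

lemma mult_inv_cancel: "\<lbrakk>a \<in> carrier G; b \<in> carrier G\<rbrakk> \<Longrightarrow> a \<otimes> (inv a \<otimes> b) = b"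
  by (simp add: m_assoc[symmetric])

definition glue :: "('a \<times> 'b) rel" where
  "glue = {((g, x), (h, y)) | g x h y. g \<in> carrier G \<and> x \<in> E \<and> h \<in> carrier G \<and> y \<in> E \<and>
     (\<exists>n\<in>N. nu n x = y \<and> inv g \<otimes> h \<otimes> n \<in> P x)}"

lemma glue_iff:
  "((g, x), (h, y)) \<in> glue \<longleftrightarrow> g \<in> carrier G \<and> x \<in> E \<and> h \<in> carrier G \<and> y \<in> E \<and>
     (\<exists>n\<in>N. nu n x = y \<and> inv g \<otimes> h \<otimes> n \<in> P x)"
  by (simp add: glue_def)

lemma N_closed [simp]: "n \<in> N \<Longrightarrow> n \<in> carrier G"
  using subgroup.mem_carrier[OF subgroup_N] .

lemma P_closed: "\<lbrakk>x \<in> E; h \<in> P x\<rbrakk> \<Longrightarrow> h \<in> carrier G"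
  using subgroup.mem_carrier[OF subgroup_P] .

lemma nu_inv: "\<lbrakk>n \<in> N; x \<in> E\<rbrakk> \<Longrightarrow> nu (inv n) (nu n x) = x"
  using nu_mult[of "inv n" n x] subgroup.m_inv_closed[OF subgroup_N] by (simp add: nu_one)

text \<open>The witness n works because inv (u n h) u n = inv h lies in \<open>P x\<close>. This is
  the rule behind the recipe for the action.\<close>

lemma glueI:
  assumes "u \<in> carrier G" "n \<in> N" "x \<in> E" "h \<in> P x"
  shows "((u \<otimes> n \<otimes> h, x), (u, nu n x)) \<in> glue"
proof -
  have h: "h \<in> carrier G" using P_closed assms by blast
  have "inv (u \<otimes> n \<otimes> h) \<otimes> u \<otimes> n = inv h"
    using assms h by (simp add: inv_mult_group m_assoc)
  moreover have "inv h \<in> P x"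
    using subgroup.m_inv_closed[OF subgroup_P] assms by blast
  ultimately show ?thesis
    using assms h nu_closed by (auto simp: glue_iff)
qed

lemma glue_left_mult:
  assumes "((a, x), (b, y)) \<in> glue" "g \<in> carrier G"
  shows "((g \<otimes> a, x), (g \<otimes> b, y)) \<in> glue"
proof -
  have ab: "a \<in> carrier G" "b \<in> carrier G"
    using assms by (auto simp: glue_iff)
  have "inv (g \<otimes> a) \<otimes> (g \<otimes> b) = inv a \<otimes> b"
    using assms ab by (metis inv_closed inv_mult_group inv_solve_left m_assoc m_closed)
  then show ?thesis
    using assms ab by (auto simp: glue_iff)
qed

lemma glue_left_mult_iff:
  assumes "g \<in> carrier G" "a \<in> carrier G" "b \<in> carrier G"
  shows "((g \<otimes> a, x), (g \<otimes> b, y)) \<in> glue \<longleftrightarrow> ((a, x), (b, y)) \<in> glue"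
proof
  assume "((g \<otimes> a, x), (g \<otimes> b, y)) \<in> glue"
  then have "((inv g \<otimes> (g \<otimes> a), x), (inv g \<otimes> (g \<otimes> b), y)) \<in> glue"
    by (rule glue_left_mult) (use assms in auto)
  then show "((a, x), (b, y)) \<in> glue"
    using assms by (simp add: inv_mult_cancel)
qed (use assms glue_left_mult in blast)

lemma equiv_glue: "equiv (carrier G \<times> E) glue"
proof (rule equivI)
  show "glue \<subseteq> (carrier G \<times> E) \<times> (carrier G \<times> E)"
    by (auto simp: glue_def)
  show "refl_on (carrier G \<times> E) glue"
  proof (rule refl_onI)
    fix a assume "a \<in> carrier G \<times> E"
    moreover obtain g x where "a = (g, x)" by (cases a)
    ultimately show "(a, a) \<in> glue"
      using glueI[of g \<one> x \<one>] subgroup.one_closed[OF subgroup_P] subgroup.one_closed[OF subgroup_N] nu_one by simp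
  qed
  show "sym glue"
  proof (rule symI)
    fix a b assume ab: "(a, b) \<in> glue"
    obtain g x h y where [simp]: "a = (g, x)" "b = (h, y)" by (metis surj_pair)
    from ab obtain n where n: "n \<in> N" "nu n x = y" "inv g \<otimes> h \<otimes> n \<in> P x"
      and c: "g \<in> carrier G" "h \<in> carrier G" "x \<in> E" "y \<in> E"
      by (auto simp: glue_iff)
    \<comment> \<open>Symmetry is witnessed by inv n: conjugation by n carries the inverted element
      from \<open>P x\<close> to \<open>P y\<close>.\<close>
    have "inv (inv g \<otimes> h \<otimes> n) \<in> P x"
      using subgroup.m_inv_closed[OF subgroup_P] n c by blast
    then have "n \<otimes> inv (inv g \<otimes> h \<otimes> n) \<otimes> inv n \<in> P y"
      using conj_P n c by blast
    moreover have "n \<otimes> inv (inv g \<otimes> h \<otimes> n) \<otimes> inv n = inv h \<otimes> g \<otimes> inv n"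
      using n c by (simp add: inv_mult_group m_assoc) (simp add: m_assoc[symmetric])
    ultimately show "(b, a) \<in> glue"
      using n c nu_inv[of n x] subgroup.m_inv_closed[OF subgroup_N, of n] by (auto simp: glue_iff)
  qed
  show "trans glue"
  proof (rule transI)
    fix a b d assume ab: "(a, b) \<in> glue" "(b, d) \<in> glue"
    obtain g x h y k z where [simp]: "a = (g, x)" "b = (h, y)" "d = (k, z)" by (metis surj_pair)
    from ab obtain n m where n: "n \<in> N" "nu n x = y" "inv g \<otimes> h \<otimes> n \<in> P x"
      and m: "m \<in> N" "nu m y = z" "inv h \<otimes> k \<otimes> m \<in> P y"
      and c: "g \<in> carrier G" "h \<in> carrier G" "k \<in> carrier G" "x \<in> E" "y \<in> E" "z \<in> E"
      by (auto simp: glue_iff)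
    have n': "inv n \<in> N" using subgroup.m_inv_closed[OF subgroup_N] n by blast
    \<comment> \<open>Transitivity is witnessed by m n: conjugation by inv n brings the second
      membership back from \<open>P y\<close> to \<open>P x\<close>, where the product of the two
      elements telescopes.\<close>
    have "inv n \<otimes> (inv h \<otimes> k \<otimes> m) \<otimes> inv (inv n) \<in> P (nu (inv n) y)"
      using conj_P n' m c by blast
    then have "inv n \<otimes> (inv h \<otimes> k \<otimes> m) \<otimes> n \<in> P x"
      using nu_inv[of n x] n c by simp
    then have "(inv g \<otimes> h \<otimes> n) \<otimes> (inv n \<otimes> (inv h \<otimes> k \<otimes> m) \<otimes> n) \<in> P x"
      using subgroup.m_closed[OF subgroup_P] n c by blast
    moreover have "(inv g \<otimes> h \<otimes> n) \<otimes> (inv n \<otimes> (inv h \<otimes> k \<otimes> m) \<otimes> n) = inv g \<otimes> k \<otimes> (m \<otimes> n)"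
      using n m c by (simp add: m_assoc mult_inv_cancel)
    moreover have "m \<otimes> n \<in> N" using subgroup.m_closed[OF subgroup_N] n m by blast
    ultimately show "(a, d) \<in> glue"
      using nu_mult[of m n x] n m c by (auto simp: glue_iff)
  qed
qed

text \<open>Defined for every point of G x E, although its values are subsets of K x E; on K x E it
  gives the classes of the restricted relation.\<close>

definition glue_class :: "'a \<times> 'b \<Rightarrow> ('a \<times> 'b) set" where
  "glue_class a = glue `` {a} \<inter> (K \<times> E)"

text \<open>The decomposition provides a point of K x E glued to a; if the traces agree, this point
  is glued to b as well.\<close>

lemma glue_class_eq_iff:
  assumes "a \<in> carrier G \<times> E" "b \<in> carrier G \<times> E"
  shows "glue_class a = glue_class b \<longleftrightarrow> (a, b) \<in> glue"
proof
  assume eq: "glue_class a = glue_class b"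
  obtain g x where a: "a = (g, x)" by (cases a)
  then obtain u n h where *: "u \<in> K" "n \<in> N" "h \<in> P x" "g = u \<otimes> n \<otimes> h" "x \<in> E"
    using assms decomposition[of g x] by auto
  then have "(a, (u, nu n x)) \<in> glue"
    using glueI[of u n x h] K_carrier a by auto
  moreover then have "(u, nu n x) \<in> glue_class a"
    using * nu_closed by (auto simp: glue_class_def)
  ultimately show "(a, b) \<in> glue"
    using eq equivE[OF equiv_glue] by (metis (no_types, lifting) IntD1 Image_singleton_iff glue_class_def symE transE)
next
  assume "(a, b) \<in> glue"
  then have "glue `` {a} = glue `` {b}"
    by (rule equiv_class_eq[OF equiv_glue])
  then show "glue_class a = glue_class b"
    by (simp add: glue_class_def)
qed

lemma glue_class_decomposition:
  assumes "u \<in> carrier G" "n \<in> N" "x \<in> E" "h \<in> P x"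
  shows "glue_class (u \<otimes> n \<otimes> h, x) = glue_class (u, nu n x)"
  using assms glueI[OF assms] nu_closed P_closed by (subst glue_class_eq_iff) auto

lemma glue_class_restrict:
  assumes "a \<in> K \<times> E"
  shows "glue_class a = (glue \<inter> (K \<times> E) \<times> (K \<times> E)) `` {a}"
  using assms by (auto simp: glue_class_def)

text \<open>Although only K x E is divided out, its classes are thereby indexed by all of G x E,
  where left multiplication makes sense.\<close>

lemma quotient_eq_glue_class:
  "(K \<times> E) // (glue \<inter> (K \<times> E) \<times> (K \<times> E)) = glue_class ` (carrier G \<times> E)"
proof -
  have "(K \<times> E) // (glue \<inter> (K \<times> E) \<times> (K \<times> E)) = glue_class ` (K \<times> E)"
    unfolding quotient_def using glue_class_restrict by (auto simp del: mem_Sigma_iff)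
  also have "glue_class ` (K \<times> E) = glue_class ` (carrier G \<times> E)"
  proof
    show "glue_class ` (carrier G \<times> E) \<subseteq> glue_class ` (K \<times> E)"
    proof
      fix c assume "c \<in> glue_class ` (carrier G \<times> E)"
      then obtain g x where gx: "c = glue_class (g, x)" "g \<in> carrier G" "x \<in> E" by auto
      then obtain u n h where "u \<in> K" "n \<in> N" "h \<in> P x" "g = u \<otimes> n \<otimes> h"
        using decomposition[of g x] by auto
      then show "c \<in> glue_class ` (K \<times> E)"
        using gx glue_class_decomposition[of u n x h] K_carrier nu_closed[of n x] by blast
    qed
  qed (use K_carrier in auto)
  finally show ?thesis .
qed

text \<open>As every class on \<open>G \<times> E\<close> meets \<open>K \<times> E\<close>, left multiplication on \<open>G \<times> E\<close> descends to classes on \<open>K \<times> E\<close>.\<close>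

lemma ex_glue_action:
  obtains act where "group_action G ((K \<times> E) // (glue \<inter> (K \<times> E) \<times> (K \<times> E))) act"
    and "\<And>g a x. \<lbrakk>g \<in> carrier G; a \<in> carrier G; x \<in> E\<rbrakk> \<Longrightarrow> act g (glue_class (a, x)) = glue_class (g \<otimes> a, x)"
proof -
  define X where "X = glue_class ` (carrier G \<times> E)"
  define rep where "rep c = (SOME a. a \<in> carrier G \<times> E \<and> glue_class a = c)" for c
  \<comment> \<open>Restricting to X makes \<open>act g\<close> extensional, as membership in
    \<open>Bij X\<close> demands.\<close>
  define act where "act g = (\<lambda>c\<in>X. glue_class (g \<otimes> fst (rep c), snd (rep c)))" for g
  have act: "act g (glue_class (a, x)) = glue_class (g \<otimes> a, x)"
    if "g \<in> carrier G" "a \<in> carrier G" "x \<in> E" for g a x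
  proof -
    have ex: "\<exists>b. b \<in> carrier G \<times> E \<and> glue_class b = glue_class (a, x)"
      using that by blast
    obtain b y where b: "rep (glue_class (a, x)) = (b, y)" by fastforce
    then have 1: "(b, y) \<in> carrier G \<times> E" "glue_class (b, y) = glue_class (a, x)"
      using someI_ex[OF ex] unfolding rep_def by auto
    then have "((b, y), (a, x)) \<in> glue"
      using glue_class_eq_iff that by auto
    then have "glue_class (g \<otimes> b, y) = glue_class (g \<otimes> a, x)"
      using glue_left_mult that 1 by (subst glue_class_eq_iff) auto
    then show ?thesis
      using b that by (simp add: act_def X_def)
  qed
  have into: "act g c \<in> X" if "g \<in> carrier G" "c \<in> X" for g c
    using that act by (auto simp: X_def)
  have comp: "act (g \<otimes> h) c = act g (act h c)" if "g \<in> carrier G" "h \<in> carrier G" "c \<in> X" for g h c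
    using that by (auto simp: X_def act m_assoc)
  have one: "act \<one> c = c" if "c \<in> X" for c
    using that by (auto simp: X_def act)
  have Bij: "act g \<in> Bij X" if g: "g \<in> carrier G" for g
  proof -
    have "bij_betw (act g) X X"
    proof (rule bij_betwI[where g = "act (inv g)"])
      show "act g \<in> X \<rightarrow> X" "act (inv g) \<in> X \<rightarrow> X" using into g by auto
      show "act (inv g) (act g c) = c" if "c \<in> X" for c
        using comp[of "inv g" g c] g that one by simp
      show "act g (act (inv g) c) = c" if "c \<in> X" for c
        using comp[of g "inv g" c] g that one by simp
    qed
    then show ?thesis by (simp add: Bij_def act_def)
  qed
  have "group_action G X act"
    unfolding group_action_def group_hom_def group_hom_axioms_def
  proof (intro conjI homI)
    show "act g \<in> carrier (BijGroup X)" if "g \<in> carrier G" for g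
      using Bij that by (simp add: BijGroup_def)
    show "act (g \<otimes> h) = act g \<otimes>\<^bsub>BijGroup X\<^esub> act h" if "g \<in> carrier G" "h \<in> carrier G" for g h
    proof
      fix c
      show "act (g \<otimes> h) c = (act g \<otimes>\<^bsub>BijGroup X\<^esub> act h) c"
        using that Bij comp by (cases "c \<in> X") (auto simp: BijGroup_def compose_def act_def)
    qed
  qed (use group_BijGroup is_group in auto)
  then show thesis
    using that act by (simp add: X_def quotient_eq_glue_class)
qed

end

section \<open>Matrices and PGL(V)\<close>

lemma GL_group_simps [simp]:
  "carrier GL_group = {A. invertible A}" "A \<otimes>\<^bsub>GL_group\<^esub> B = A ** B" "\<one>\<^bsub>GL_group\<^esub> = mat 1"
  by (simp_all add: GL_group_def)

lemma invertible_inverse: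
  assumes "invertible (A :: 'k::field^'n^'n)"
  obtains B where "invertible B" "A ** B = mat 1" "B ** A = mat 1"
  using assms unfolding invertible_def by blast

lemma mat_mult_left: "mat c ** A = (\<chi> i j. c * A $ i $ j)" for A :: "'k::field^'n::finite^'m::finite"
  by (simp add: vec_eq_iff matrix_matrix_mult_def mat_def if_distrib[of "\<lambda>x. x * _"] cong: if_cong)

lemma mat_mult_right: "A ** mat c = (\<chi> i j. c * A $ i $ j)" for A :: "'k::field^'n::finite^'m::finite"
  by (simp add: vec_eq_iff matrix_matrix_mult_def mat_def if_distrib[of "\<lambda>x. _ * x"] mult.commute cong: if_cong)

lemma mat_mult_mat: "mat c ** mat d = (mat (c * d) :: 'k::field^'n::finite^'n)"
  by (simp add: mat_mult_left) (simp add: mat_def vec_eq_iff)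

lemma invertible_mat: "c \<noteq> 0 \<Longrightarrow> invertible (mat c :: 'k::field^'n::finite^'n)"
  unfolding invertible_def by (intro exI[of _ "mat (inverse c)"]) (simp add: mat_mult_mat)

lemma group_GL_group: "group (GL_group :: ('k::field^'n::finite^'n) monoid)"
proof (rule groupI)
  fix A :: "'k^'n^'n" assume "A \<in> carrier GL_group"
  then show "\<exists>B\<in>carrier GL_group. B \<otimes>\<^bsub>GL_group\<^esub> A = \<one>\<^bsub>GL_group\<^esub>"
    using invertible_inverse[of A] by auto
qed (auto simp: invertible_mult matrix_mul_assoc invertible_mat)

lemma scalar_matrices_normal: "scalar_matrices \<lhd> (GL_group :: ('k::field^'n::finite^'n) monoid)"
proof -
  interpret group "GL_group :: ('k^'n^'n) monoid" by (rule group_GL_group)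
  have sub: "subgroup scalar_matrices (GL_group :: ('k^'n^'n) monoid)"
  proof (rule subgroupI)
    fix A :: "'k^'n^'n" assume "A \<in> scalar_matrices"
    then obtain c where c: "A = mat c" "c \<noteq> 0" by (auto simp: scalar_matrices_def)
    have "inv\<^bsub>GL_group\<^esub> A = mat (inverse c)"
      using c by (intro inv_equality) (auto simp: mat_mult_mat invertible_mat)
    then show "inv\<^bsub>GL_group\<^esub> A \<in> scalar_matrices"
      using c by (auto simp: scalar_matrices_def)
  next
    fix A B :: "'k^'n^'n" assume "A \<in> scalar_matrices" "B \<in> scalar_matrices"
    then show "A \<otimes>\<^bsub>GL_group\<^esub> B \<in> scalar_matrices"
      by (auto simp: scalar_matrices_def mat_mult_mat)
  qed (auto simp: scalar_matrices_def invertible_mat intro: exI[of _ 1])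
  show ?thesis
  proof (rule normalI[OF sub], rule ballI)
    fix A :: "'k^'n^'n"
    show "scalar_matrices #>\<^bsub>GL_group\<^esub> A = A <#\<^bsub>GL_group\<^esub> scalar_matrices"
      by (auto simp: r_coset_def l_coset_def scalar_matrices_def mat_mult_left mat_mult_right)
  qed
qed

lemma group_PGL: "group (PGL :: ('k::field, 'n::finite) pgl monoid)"
  unfolding PGL_def by (rule normal.factorgroup_is_group[OF scalar_matrices_normal])

interpretation PGL: group PGL
  by (rule group_PGL)

lemma to_PGL_closed [simp]: "invertible A \<Longrightarrow> to_PGL A \<in> carrier PGL"
  by (auto simp: PGL_def FactGroup_def to_PGL_def RCOSETS_def)

lemma PGL_cases:
  assumes "g \<in> carrier PGL"
  obtains A where "invertible A" "g = to_PGL A"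
  using assms by (auto simp: PGL_def FactGroup_def to_PGL_def RCOSETS_def)

lemma to_PGL_mult [simp]:
  "invertible A \<Longrightarrow> invertible B \<Longrightarrow> to_PGL A \<otimes>\<^bsub>PGL\<^esub> to_PGL B = to_PGL (A ** B)"
  using normal.rcos_sum[OF scalar_matrices_normal, of A B]
  by (simp add: PGL_def FactGroup_def to_PGL_def)

lemma one_PGL: "\<one>\<^bsub>PGL\<^esub> = to_PGL (mat 1)"
  by (auto simp: PGL_def FactGroup_def to_PGL_def r_coset_def)

lemma to_PGL_eqD:
  fixes A B :: "'k::field^'n::finite^'n"
  assumes "to_PGL A = to_PGL B"
  obtains c where "c \<noteq> 0" "\<And>i j. B $ i $ j = c * A $ i $ j"
proof -
  have "mat 1 ** B \<in> to_PGL B"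
    unfolding to_PGL_def r_coset_def scalar_matrices_def GL_group_simps using one_neq_zero[where 'a = 'k] by blast
  then have "mat 1 ** B \<in> to_PGL A" using assms by simp
  then obtain c where "c \<noteq> 0" "B = mat c ** A"
    unfolding to_PGL_def r_coset_def scalar_matrices_def by auto
  then show thesis using that by (auto simp: mat_mult_left)
qed

subsection \<open>Transvections and monomial matrices\<close>

lemma root_matrix_mult:
  "i \<noteq> j \<Longrightarrow> root_matrix i j \<omega> ** A = (\<chi> k l. if k = i then A $ i $ l + \<omega> * A $ j $ l else A $ k $ l)"
proof -
  assume ij: "i \<noteq> j"
  \<comment> \<open>The diagonal and the off-diagonal entry of the transvection each contribute one
    Kronecker delta.\<close>
  have "(\<Sum>m\<in>UNIV. root_matrix i j \<omega> $ k $ m * A $ m $ l) =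
      (\<Sum>m\<in>UNIV. if m = k then A $ k $ l else 0) + (\<Sum>m\<in>UNIV. if m = j then (if k = i then \<omega> * A $ j $ l else 0) else 0)" for k l
    unfolding sum.distrib[symmetric] using ij by (intro sum.cong) (auto simp: root_matrix_def)
  then show ?thesis
    by (simp add: vec_eq_iff matrix_matrix_mult_def)
qed

lemma mult_root_matrix:
  "i \<noteq> j \<Longrightarrow> A ** root_matrix i j \<omega> = (\<chi> k l. if l = j then A $ k $ j + \<omega> * A $ k $ i else A $ k $ l)"
proof -
  assume ij: "i \<noteq> j"
  have "(\<Sum>m\<in>UNIV. A $ k $ m * root_matrix i j \<omega> $ m $ l) =
      (\<Sum>m\<in>UNIV. if m = l then A $ k $ l else 0) + (\<Sum>m\<in>UNIV. if m = i then (if l = j then \<omega> * A $ k $ i else 0) else 0)" for k l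
    unfolding sum.distrib[symmetric] using ij by (intro sum.cong) (auto simp: root_matrix_def)
  then show ?thesis
    by (simp add: vec_eq_iff matrix_matrix_mult_def)
qed

lemma invertible_root_matrix:
  assumes "i \<noteq> j"
  shows "invertible (root_matrix i j \<omega> :: 'k::field^'n::finite^'n)"
proof -
  have "root_matrix i j \<omega> ** root_matrix i j (- \<omega>) = (mat 1 :: 'k^'n^'n)"
    unfolding root_matrix_mult[OF assms] vec_eq_iff
  proof (intro allI)
    fix k l
    show "(\<chi> k l. if k = i then root_matrix i j (- \<omega>) $ i $ l + \<omega> * root_matrix i j (- \<omega>) $ j $ l
        else root_matrix i j (- \<omega>) $ k $ l) $ k $ l = (mat 1 :: 'k^'n^'n) $ k $ l"
      unfolding vec_lambda_beta root_matrix_def mat_def using assms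
      by (cases "k = i"; cases "l = j"; cases "k = l"; simp)
  qed
  then show ?thesis
    unfolding invertible_right_inverse by (rule exI)
qed

text \<open>The product of \<open>diagonal_matrix t\<close> and \<open>permutation_matrix w\<close>;
  \<open>t\<close> is indexed by rows because the diagonal factor stands on the left.\<close>

definition monomial_matrix :: "('n::finite \<Rightarrow> 'k::field) \<Rightarrow> ('n \<Rightarrow> 'n) \<Rightarrow> 'k^'n^'n" where
  "monomial_matrix t w = (\<chi> i j. if i = w j then t i else 0)"

lemma diagonal_mult_permutation: "diagonal_matrix t ** permutation_matrix w = monomial_matrix t w"
  by (simp add: vec_eq_iff matrix_matrix_mult_def diagonal_matrix_def permutation_matrix_def monomial_matrix_def
      if_distrib[of "\<lambda>x. x * _"] cong: if_cong)

lemma monomial_matrix_mult: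
  assumes "bij w"
  shows "monomial_matrix t w ** A = (\<chi> k l. t k * A $ inv_into UNIV w k $ l)"
proof -
  have "k = w m \<longleftrightarrow> m = inv_into UNIV w k" for k m
    using assms by (metis bij_inv_eq_iff)
  then show ?thesis
    by (simp add: vec_eq_iff matrix_matrix_mult_def monomial_matrix_def if_distrib[of "\<lambda>x. x * _"] cong: if_cong)
qed

lemma monomial_matrix_mult_monomial:
  assumes "bij w"
  shows "monomial_matrix t w ** monomial_matrix s u = monomial_matrix (\<lambda>k. t k * s (inv_into UNIV w k)) (w \<circ> u)"
proof -
  have "inv_into UNIV w k = u l \<longleftrightarrow> k = w (u l)" for k l
    using assms by (metis bij_inv_eq_iff)
  then show ?thesis
    using assms by (simp add: monomial_matrix_mult vec_eq_iff) (auto simp: monomial_matrix_def)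
qed

lemma monomial_matrix_id: "monomial_matrix (\<lambda>_. 1) id = mat 1"
  by (simp add: monomial_matrix_def mat_def)

lemma monomial_matrix_inverse:
  assumes "bij w" "\<And>i. t i \<noteq> 0"
  shows "monomial_matrix t w ** monomial_matrix (\<lambda>k. inverse (t (w k))) (inv_into UNIV w) = mat 1"
proof -
  have "w \<circ> inv_into UNIV w = id" "\<And>k. w (inv_into UNIV w k) = k"
    using assms(1) bij_is_surj surj_iff surj_f_inv_f by metis+
  then show ?thesis
    using assms(2) by (simp add: monomial_matrix_mult_monomial[OF assms(1)] flip: monomial_matrix_id)
qed

lemma invertible_monomial_matrix:
  "bij w \<Longrightarrow> (\<And>i. t i \<noteq> 0) \<Longrightarrow> invertible (monomial_matrix t w)"
  using monomial_matrix_inverse[of w t] invertible_right_inverse by blast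

text \<open>Conjugation of a transvection, written as a commutation rule so that no inverse matrix
  occurs; \<open>t (w i) / t (w j)\<close> is the value on diag(t) of the root attached to (w i, w
  j).\<close>

lemma monomial_conj_root_matrix:
  assumes "bij w" "\<And>k. t k \<noteq> 0" "i \<noteq> j"
  shows "monomial_matrix t w ** root_matrix i j \<omega> =
    root_matrix (w i) (w j) (\<omega> * t (w i) / t (w j)) ** monomial_matrix t w"
proof -
  have "w i \<noteq> w j" "\<And>k. w k = w i \<longleftrightarrow> k = i" "\<And>k. w i = w k \<longleftrightarrow> i = k" "\<And>k. w j = w k \<longleftrightarrow> j = k"
    using assms(1,3) by (auto simp: bij_def dest: injD)
  then show ?thesis
    using assms by (simp add: mult_root_matrix root_matrix_mult vec_eq_iff) (auto simp: monomial_matrix_def)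
qed

lemma monomial_group_eq:
  "monomial_group = {to_PGL (monomial_matrix t w) | t w. (\<forall>i. t i \<noteq> 0) \<and> bij w}"
  by (simp add: monomial_group_def diagonal_mult_permutation)

lemma monomial_groupI:
  "(\<And>i. t i \<noteq> 0) \<Longrightarrow> bij w \<Longrightarrow> to_PGL (monomial_matrix t w) \<in> monomial_group"
  by (auto simp: monomial_group_eq)

lemma monomial_groupE:
  assumes "n \<in> monomial_group"
  obtains t w where "\<And>i. t i \<noteq> 0" "bij w" "n = to_PGL (monomial_matrix t w)"
  using assms by (auto simp: monomial_group_eq)

text \<open>Needed for \<open>nu\<close> to be well defined: the positions of the nonzero entries
  recover the permutation, and a common scalar is the only freedom left in the entries.\<close>

lemma to_PGL_monomial_eqD:
  assumes "to_PGL (monomial_matrix t w) = to_PGL (monomial_matrix s u)"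
    and "\<And>i. t i \<noteq> 0" "\<And>i. s i \<noteq> 0" "bij w" "bij u"
  obtains c where "c \<noteq> 0" "u = w" "s = (\<lambda>i. c * t i)"
proof -
  obtain c where c: "c \<noteq> 0" "\<And>i j. monomial_matrix s u $ i $ j = c * monomial_matrix t w $ i $ j"
    using to_PGL_eqD[OF assms(1)] by blast
  have "u j = w j" for j
    using c(2)[of "u j" j] assms(3)[of "u j"] by (auto simp: monomial_matrix_def split: if_splits)
  then have uw: "u = w" by auto
  have "s (w j) = c * t (w j)" for j
    using c(2)[of "w j" j] uw by (simp add: monomial_matrix_def)
  then have "s = (\<lambda>i. c * t i)"
    using assms(4) by (metis bij_pointE)
  with c uw show thesis using that by blast
qed

lemma subgroup_monomial_group: "subgroup (monomial_group :: ('k::field, 'n::finite) pgl set) PGL"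
proof (rule PGL.subgroupI)
  show "(monomial_group :: ('k, 'n) pgl set) \<subseteq> carrier PGL"
    by (auto simp: monomial_group_eq invertible_monomial_matrix)
  show "(monomial_group :: ('k, 'n) pgl set) \<noteq> {}"
    using monomial_groupI[of "\<lambda>_. 1" id] by auto
  fix g h :: "('k, 'n) pgl" assume g: "g \<in> monomial_group"
  then obtain t w where tw: "\<And>i. t i \<noteq> 0" "bij w" "g = to_PGL (monomial_matrix t w)"
    by (rule monomial_groupE) blast
  let ?s = "\<lambda>k. inverse (t (w k))"
  have s: "\<And>k. ?s k \<noteq> 0" "bij (inv_into UNIV w)" using tw by (simp_all add: bij_imp_bij_inv)
  have "inv\<^bsub>PGL\<^esub> g = to_PGL (monomial_matrix ?s (inv_into UNIV w))"
  proof (rule PGL.inv_equality)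
    have "monomial_matrix ?s (inv_into UNIV w) ** monomial_matrix t w = mat 1"
      using monomial_matrix_inverse[of w t] tw matrix_left_right_inverse by blast
    then show "to_PGL (monomial_matrix ?s (inv_into UNIV w)) \<otimes>\<^bsub>PGL\<^esub> g = \<one>\<^bsub>PGL\<^esub>"
      using tw s by (simp add: invertible_monomial_matrix one_PGL)
  qed (use tw s in \<open>simp_all add: invertible_monomial_matrix\<close>)
  then show "inv\<^bsub>PGL\<^esub> g \<in> monomial_group"
    using s monomial_groupI by metis
  assume "h \<in> monomial_group"
  then obtain r u where "\<And>i. r i \<noteq> 0" "bij u" "h = to_PGL (monomial_matrix r u)"
    by (rule monomial_groupE) blast
  then show "g \<otimes>\<^bsub>PGL\<^esub> h \<in> monomial_group"
    using tw by (auto simp: invertible_monomial_matrix monomial_matrix_mult_monomial bij_comp intro!: monomial_groupI)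
qed

section \<open>The compactified apartment\<close>

lemma topspace_final_topology:
  assumes "f ` topspace X \<subseteq> Y"
  shows "topspace (final_topology Y X f) = Y"
proof -
  have "{x \<in> topspace X. f x \<in> Y} = topspace X"
    using assms by blast
  then have "openin (final_topology Y X f) Y"
    by (simp add: openin_final_topology)
  moreover have "openin (final_topology Y X f) (topspace (final_topology Y X f))"
    by simp
  ultimately show ?thesis
    by (meson openin_final_topology openin_subset subset_antisym)
qed

section \<open>Points of the strata and the topology of the apartment\<close>

lemma apt_pt_eq_iff: "apt_pt I x = apt_pt J y \<longleftrightarrow> I = J \<and> (\<exists>c. \<forall>i\<in>I. x $ i = y $ i + c)"
proof
  assume eq: "apt_pt I x = apt_pt J y"
  have "x \<in> {y. \<exists>c. \<forall>i\<in>I. y $ i = x $ i + c}"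
    by (auto intro: exI[of _ 0])
  then have "x \<in> {z. \<exists>c. \<forall>i\<in>J. z $ i = y $ i + c}" and "I = J"
    using eq unfolding apt_pt_def prod.inject by metis+
  then show "I = J \<and> (\<exists>c. \<forall>i\<in>I. x $ i = y $ i + c)"
    by blast
next
  assume "I = J \<and> (\<exists>c. \<forall>i\<in>I. x $ i = y $ i + c)"
  then obtain c where c: "I = J" "\<And>i. i \<in> I \<Longrightarrow> x $ i = y $ i + c"
    by blast
  have "(\<exists>d. \<forall>i\<in>I. z $ i = x $ i + d) \<longleftrightarrow> (\<exists>d. \<forall>i\<in>I. z $ i = y $ i + d)" for z
  proof
    assume "\<exists>d. \<forall>i\<in>I. z $ i = x $ i + d"
    then obtain d where "\<And>i. i \<in> I \<Longrightarrow> z $ i = x $ i + d" by blast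
    then show "\<exists>d. \<forall>i\<in>I. z $ i = y $ i + d"
      using c by (intro exI[of _ "d + c"]) simp
  next
    assume "\<exists>d. \<forall>i\<in>I. z $ i = y $ i + d"
    then obtain d where "\<And>i. i \<in> I \<Longrightarrow> z $ i = y $ i + d" by blast
    then show "\<exists>d. \<forall>i\<in>I. z $ i = x $ i + d"
      using c by (intro exI[of _ "d - c"]) simp
  qed
  then show "apt_pt I x = apt_pt J y"
    using c by (simp add: apt_pt_def)
qed

lemma compact_apartment_eq: "compact_apartment = {apt_pt I x | I x. I \<noteq> {}}"
  by (auto simp: compact_apartment_def stratum_def)

lemma apt_pt_in_compact_apartment [simp]: "apt_pt I x \<in> compact_apartment \<longleftrightarrow> I \<noteq> {}"
  unfolding compact_apartment_eq using apt_pt_eq_iff by blast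

lemma compact_apartmentE:
  assumes "P \<in> compact_apartment"
  obtains I x where "I \<noteq> {}" "P = apt_pt I x"
  using assms by (auto simp: compact_apartment_eq)

lemma apt_pt_in_apartment [simp]: "apt_pt I x \<in> apartment \<longleftrightarrow> I = UNIV"
  by (auto simp: stratum_def apt_pt_eq_iff intro: exI[of _ 0])

lemma apartment_subset_compact_apartment: "apartment \<subseteq> compact_apartment"
  by (auto simp: compact_apartment_def)

lemma topspace_apartment_topology [simp]: "topspace apartment_topology = apartment"
  unfolding apartment_topology_def by (rule topspace_final_topology) (simp add: stratum_def)

lemma openin_apartment_iff:
  "openin apartment_topology U \<longleftrightarrow> U \<subseteq> apartment \<and> open {x. apt_pt UNIV x \<in> U}"
  by (simp add: apartment_topology_def openin_final_topology)

lemma apt_pt_shift: "apt_pt UNIV (x + (\<chi> i. c)) = apt_pt UNIV x"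
  by (auto simp: apt_pt_eq_iff)

lemma apt_pt_UNIV_eqE:
  assumes "apt_pt UNIV x = apt_pt UNIV y"
  obtains c where "x = y + (\<chi> i. c)"
  using assms by (auto simp: apt_pt_eq_iff vec_eq_iff)

text \<open>The projection to the apartment is open, since saturating B means taking all its
  translates along the diagonal line.\<close>

lemma openin_apartment_image:
  assumes "open B"
  shows "openin apartment_topology (apt_pt UNIV ` B)"
proof -
  have "{x. apt_pt UNIV x \<in> apt_pt UNIV ` B} = (\<Union>c. (\<lambda>x. (\<chi> i. c) + x) ` B)" (is "?L = ?R")
  proof
    show "?L \<subseteq> ?R"
    proof
      fix x assume "x \<in> ?L"
      then obtain b where b: "b \<in> B" "apt_pt UNIV x = apt_pt UNIV b" by auto
      then obtain c where "x = b + (\<chi> i. c)" by (elim apt_pt_UNIV_eqE)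
      then have "x = (\<chi> i. c) + b" by (simp add: add.commute)
      then show "x \<in> ?R" using b by blast
    qed
    show "?R \<subseteq> ?L"
      using apt_pt_shift by (auto simp: add.commute)
  qed
  then show ?thesis
    using assms by (auto simp: openin_apartment_iff intro!: open_translation)
qed

text \<open>The preimage in coordinate space is a union of translates of an open set by the vectors
  of D_I.\<close>

lemma openin_plus_cone:
  assumes "openin apartment_topology U"
  shows "openin apartment_topology (plus_cone U I)"
proof -
  define D where "D = {d :: real^'a. (\<forall>i\<in>I. d $ i = 0) \<and> (\<forall>i. i \<notin> I \<longrightarrow> d $ i \<le> 0)}"
  have "{y. apt_pt UNIV y \<in> plus_cone U I} = (\<Union>d\<in>D. (\<lambda>x. d + x) ` {x. apt_pt UNIV x \<in> U})" (is "?L = ?R")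
  proof
    show "?L \<subseteq> ?R"
    proof
      fix y assume "y \<in> ?L"
      then obtain x d where xd: "apt_pt UNIV y = apt_pt UNIV (x + d)" "apt_pt UNIV x \<in> U" "d \<in> D"
        by (auto simp: plus_cone_def D_def)
      then obtain c where "y = x + d + (\<chi> i. c)" by (elim apt_pt_UNIV_eqE)
      then have "y = d + (x + (\<chi> i. c))" by (simp add: algebra_simps)
      moreover have "apt_pt UNIV (x + (\<chi> i. c)) \<in> U" using xd apt_pt_shift by metis
      ultimately show "y \<in> ?R" using xd by blast
    qed
    show "?R \<subseteq> ?L"
    proof
      fix y assume "y \<in> ?R"
      then obtain x d where "y = x + d" "d \<in> D" "apt_pt UNIV x \<in> U"
        by (auto simp: add.commute)
      then show "y \<in> ?L"
        unfolding plus_cone_def D_def by blast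
    qed
  qed
  moreover have "plus_cone U I \<subseteq> apartment"
    by (auto simp: plus_cone_def)
  ultimately show ?thesis
    using assms by (auto simp: openin_apartment_iff intro!: open_translation)
qed

text \<open>Since \<open>stratum_map J\<close> sends \<open>apt_pt UNIV x\<close> to
  \<open>apt_pt J x\<close>, the cone itself is the case J = UNIV and one formula covers all
  strata.\<close>

lemma corner_nhd_eq:
  "corner_nhd I U = {apt_pt J (x + d) | J x d. I \<subseteq> J \<and> apt_pt UNIV x \<in> U \<and>
     (\<forall>i\<in>I. d $ i = 0) \<and> (\<forall>i. i \<notin> I \<longrightarrow> d $ i \<le> 0)}" (is "_ = ?R")
proof
  show "corner_nhd I U \<subseteq> ?R"
  proof
    fix P assume "P \<in> corner_nhd I U"
    then consider "P \<in> plus_cone U I" | J where "I \<subseteq> J" "P \<in> stratum_map J ` plus_cone U I"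
      unfolding corner_nhd_def by blast
    then show "P \<in> ?R"
    proof cases
      case 1
      then show ?thesis unfolding plus_cone_def by blast
    next
      case 2
      then obtain x d where "apt_pt UNIV x \<in> U" "\<forall>i\<in>I. d $ i = 0" "\<forall>i. i \<notin> I \<longrightarrow> d $ i \<le> 0"
        and "P = stratum_map J (apt_pt UNIV (x + d))"
        unfolding plus_cone_def by blast
      then show ?thesis using 2 unfolding stratum_map_apt_pt by blast
    qed
  qed
  show "?R \<subseteq> corner_nhd I U"
  proof
    fix P assume "P \<in> ?R"
    then obtain J x d where *: "P = apt_pt J (x + d)" "I \<subseteq> J" "apt_pt UNIV (x + d) \<in> plus_cone U I"
      unfolding plus_cone_def by blast
    show "P \<in> corner_nhd I U"
    proof (cases "J = UNIV")
      case True
      then show ?thesis using * by (simp add: corner_nhd_def)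
    next
      case False
      have "P = stratum_map J (apt_pt UNIV (x + d))"
        using *(1) by (simp only: stratum_map_apt_pt)
      then show ?thesis using False * unfolding corner_nhd_def by blast
    qed
  qed
qed

section \<open>Neighbourhoods of boundary points and the topology induced on the apartment\<close>

lemma openin_corner_nhd:
  assumes "I \<noteq> {}" "I \<noteq> UNIV" "open B" "bounded B"
  shows "openin compact_apartment_topology (corner_nhd I (apt_pt UNIV ` B))"
  unfolding compact_apartment_topology_def
  by (rule topology_generated_by_Basis) (use assms openin_apartment_image in \<open>auto simp: bounded_in_apartment_def\<close>)

lemma openin_compact_apartment_if_openin_apartment:
  "openin apartment_topology U \<Longrightarrow> openin compact_apartment_topology U"
  unfolding compact_apartment_topology_def by (rule topology_generated_by_Basis) simp

text \<open>The ambiguity of representatives by a constant is absorbed, so that y lies in B itself.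
  Interior points are included, with d = 0, which spares later case distinctions.\<close>

lemma ex_corner_nhd:
  fixes x :: "real^'n::finite"
  assumes "I \<noteq> {}" "open B" "bounded B" "x \<in> B"
  obtains W where "openin compact_apartment_topology W" "apt_pt I x \<in> W"
    "W \<subseteq> {apt_pt J (y + d) | J y d. I \<subseteq> J \<and> y \<in> B \<and> (\<forall>i\<in>I. d $ i = 0) \<and> (\<forall>i. d $ i \<le> 0)}"
proof (cases "I = UNIV")
  case True
  show ?thesis
  proof (rule that)
    show "openin compact_apartment_topology (apt_pt UNIV ` B)"
      using assms by (intro openin_compact_apartment_if_openin_apartment openin_apartment_image)
    show "apt_pt UNIV ` B \<subseteq> {apt_pt J (y + d) | J y d. I \<subseteq> J \<and> y \<in> B \<and> (\<forall>i\<in>I. d $ i = 0) \<and> (\<forall>i. d $ i \<le> 0)}"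
    proof
      fix P assume "P \<in> apt_pt UNIV ` B"
      then obtain y where "P = apt_pt UNIV (y + 0)" "y \<in> B" by auto
      moreover have "I \<subseteq> UNIV" "\<forall>i\<in>I. (0 :: real^'n) $ i = 0" "\<forall>i. (0 :: real^'n) $ i \<le> 0" by auto
      ultimately show "P \<in> {apt_pt J (y + d) | J y d. I \<subseteq> J \<and> y \<in> B \<and> (\<forall>i\<in>I. d $ i = 0) \<and> (\<forall>i. d $ i \<le> 0)}"
        by blast
    qed
  qed (use True assms in auto)
next
  case False
  show ?thesis
  proof (rule that)
    show "openin compact_apartment_topology (corner_nhd I (apt_pt UNIV ` B))"
      using False assms by (intro openin_corner_nhd)
    have "apt_pt UNIV x \<in> apt_pt UNIV ` B" using assms by blast
    moreover have "apt_pt I x = apt_pt I (x + 0)" "\<forall>i\<in>I. (0 :: real^'n) $ i = 0" "\<forall>i. i \<notin> I \<longrightarrow> (0 :: real^'n) $ i \<le> 0"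
      by simp_all
    ultimately show "apt_pt I x \<in> corner_nhd I (apt_pt UNIV ` B)"
      unfolding corner_nhd_eq by blast
    show "corner_nhd I (apt_pt UNIV ` B) \<subseteq> {apt_pt J (y + d) | J y d. I \<subseteq> J \<and> y \<in> B \<and> (\<forall>i\<in>I. d $ i = 0) \<and> (\<forall>i. d $ i \<le> 0)}"
    proof
      fix P assume "P \<in> corner_nhd I (apt_pt UNIV ` B)"
      then obtain J x d b where P: "P = apt_pt J (x + d)" "I \<subseteq> J" "\<forall>i\<in>I. d $ i = 0" "\<forall>i. i \<notin> I \<longrightarrow> d $ i \<le> 0"
        and b: "b \<in> B" "apt_pt UNIV x = apt_pt UNIV b"
        unfolding corner_nhd_eq by blast
      then obtain c where "x = b + (\<chi> i. c)" by (elim apt_pt_UNIV_eqE)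
      have le: "\<forall>i. d $ i \<le> 0"
        using P(3,4) by (metis order_refl)
      from \<open>x = b + (\<chi> i. c)\<close> have "P = apt_pt J (b + d)"
        using P by (auto simp: apt_pt_eq_iff)
      then show "P \<in> {apt_pt J (y + d) | J y d. I \<subseteq> J \<and> y \<in> B \<and> (\<forall>i\<in>I. d $ i = 0) \<and> (\<forall>i. d $ i \<le> 0)}"
        using P b le by blast
    qed
  qed
qed

lemma topspace_compact_apartment_topology [simp]:
  "topspace (compact_apartment_topology :: 'n::finite apt_point topology) = compact_apartment"
proof
  show "topspace (compact_apartment_topology :: 'n apt_point topology) \<subseteq> compact_apartment"
    using apartment_subset_compact_apartment openin_subset
    by (fastforce simp: compact_apartment_topology_def topology_generated_by_topspace corner_nhd_eq)
  show "compact_apartment \<subseteq> topspace (compact_apartment_topology :: 'n apt_point topology)"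
  proof
    fix P :: "'n apt_point" assume "P \<in> compact_apartment"
    then obtain I x where I: "I \<noteq> {}" "P = apt_pt I x" by (rule compact_apartmentE)
    obtain W where "openin compact_apartment_topology W" "apt_pt I x \<in> W"
      by (rule ex_corner_nhd[of I "ball x 1" x]) (use I in auto)
    then show "P \<in> topspace (compact_apartment_topology :: 'n apt_point topology)"
      using I openin_subset by blast
  qed
qed

text \<open>Open sets of the apartment are among the generators; conversely every generator meets
  the apartment in an open set, a corner neighbourhood in its cone. The converse is phrased as
  continuity of the identity, so that only generators need checking.\<close>

lemma apartment_topology_eq_subtopology:
  "apartment_topology = subtopology compact_apartment_topology (apartment :: 'n::finite apt_point set)"
proof (rule topology_eq[THEN iffD2], intro allI iffI)
  fix S :: "'n apt_point set"
  assume S: "openin apartment_topology S"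
  then have "openin compact_apartment_topology S"
    by (rule openin_compact_apartment_if_openin_apartment)
  moreover have "S \<subseteq> apartment"
    using S by (simp add: openin_apartment_iff)
  ultimately show "openin (subtopology compact_apartment_topology apartment) S"
    unfolding openin_subtopology by blast
next
  fix S :: "'n apt_point set"
  assume "openin (subtopology compact_apartment_topology apartment) S"
  then obtain T where T: "openin compact_apartment_topology T" "S = T \<inter> apartment"
    unfolding openin_subtopology by blast
  have "continuous_map apartment_topology (compact_apartment_topology :: 'n apt_point topology) id"
    unfolding compact_apartment_topology_def
  proof (rule continuous_on_generated_topo)
    fix U :: "'n apt_point set"
    assume "U \<in> {U. openin apartment_topology U} \<union>
      {corner_nhd I U | I U. I \<noteq> {} \<and> I \<noteq> UNIV \<and> openin apartment_topology U \<and> bounded_in_apartment U}"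
    then consider "openin apartment_topology U" | I V where "U = corner_nhd I V" "openin apartment_topology V"
      by blast
    then show "openin apartment_topology (id -` U \<inter> topspace apartment_topology)"
    proof cases
      case 2
      have "corner_nhd I V \<inter> apartment = plus_cone V I"
        by (auto simp: corner_nhd_def plus_cone_def stratum_map_apt_pt)
      then show ?thesis
        using 2 openin_plus_cone by simp
    next
      case 1
      then show ?thesis
        using openin_subset[OF 1] by (simp add: Int_absorb2)
    qed
  next
    have "openin apartment_topology (apartment :: 'n apt_point set)"
      using openin_topspace[of "apartment_topology :: 'n apt_point topology"] by simp
    then show "id ` topspace apartment_topology \<subseteq> \<Union> ({U :: 'n apt_point set. openin apartment_topology U} \<union>
      {corner_nhd I U | I U. I \<noteq> {} \<and> I \<noteq> UNIV \<and> openin apartment_topology U \<and> bounded_in_apartment U})"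
      by auto
  qed
  from openin_continuous_map_preimage[OF this T(1)]
  show "openin apartment_topology S"
    using T(2) by (simp add: Int_commute Collect_conj_eq)
qed

lemma openin_compact_apartment_apartment: "openin compact_apartment_topology apartment"
  using openin_compact_apartment_if_openin_apartment[OF openin_topspace] by simp

text \<open>The point \<open>r\<^sub>I(x)\<close> is the limit of \<open>x + d\<close> as the coordinates of \<open>d\<close> outside \<open>I\<close> tend to \<open>-\<infinity>\<close>.\<close>

lemma corner_limit:
  assumes "openin compact_apartment_topology W" "apt_pt I x \<in> W"
  shows "\<exists>K. \<forall>d. (\<forall>i\<in>I. d $ i = 0) \<longrightarrow> (\<forall>i. i \<notin> I \<longrightarrow> d $ i \<le> - K) \<longrightarrow> apt_pt UNIV (x + d) \<in> W"
proof -
  have "generate_topology_on ({U. openin apartment_topology U} \<union>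
      {corner_nhd I U | I U. I \<noteq> {} \<and> I \<noteq> UNIV \<and> openin apartment_topology U \<and> bounded_in_apartment U}) W"
    using assms(1) unfolding compact_apartment_topology_def by (rule openin_topology_generated_by)
  then show ?thesis
    using assms(2)
  proof induction
    case Empty
    then show ?case by simp
  next
    case (Int a b)
    then obtain K L where
      "\<And>d. (\<forall>i\<in>I. d $ i = 0) \<Longrightarrow> (\<forall>i. i \<notin> I \<longrightarrow> d $ i \<le> - K) \<Longrightarrow> apt_pt UNIV (x + d) \<in> a"
      "\<And>d. (\<forall>i\<in>I. d $ i = 0) \<Longrightarrow> (\<forall>i. i \<notin> I \<longrightarrow> d $ i \<le> - L) \<Longrightarrow> apt_pt UNIV (x + d) \<in> b"
      by blast
    then show ?case
      by (intro exI[of _ "max K L"]) fastforce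
  next
    case (UN \<K>)
    then show ?case by (meson UnionE UnionI)
  next
    case (Basis s)
    then consider "openin apartment_topology s" | I' U where "s = corner_nhd I' U"
      by blast
    then show ?case
    proof cases
      case 1
      \<comment> \<open>An open subset of the apartment contains no boundary point, so d is forced
        to vanish.\<close>
      then have "I = UNIV"
        using Basis apt_pt_in_apartment unfolding openin_apartment_iff by blast
      then have "x + d = x" if "\<forall>i\<in>I. d $ i = 0" for d
        using that by (simp add: vec_eq_iff)
      then show ?thesis
        using Basis \<open>I = UNIV\<close> by metis
    next
      case 2
      then obtain u e c where u: "I' \<subseteq> I" "apt_pt UNIV u \<in> U" "\<forall>i\<in>I'. e $ i = 0" "\<forall>i. i \<notin> I' \<longrightarrow> e $ i \<le> 0"
        and c: "\<forall>i\<in>I. x $ i = u $ i + e $ i + c"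
        using Basis(2) unfolding corner_nhd_eq by (auto simp: apt_pt_eq_iff)
      \<comment> \<open>The vector e' = x + d - u - c agrees with e on I. Outside I it must be
        nonpositive, and there d <= -K offsets the largest coordinate of x - u - c.\<close>
      define K where "K = Max (range (\<lambda>i. x $ i - u $ i - c))"
      have K: "x $ i - u $ i - c \<le> K" for i
        unfolding K_def by (rule Max_ge) auto
      show ?thesis
      proof (intro exI[of _ K] allI impI)
        fix d :: "real^'a" assume d: "\<forall>i\<in>I. d $ i = 0" "\<forall>i. i \<notin> I \<longrightarrow> d $ i \<le> - K"
        define e' where "e' = x + d - u - (\<chi> i. c)"
        have "e' $ i = e $ i" if "i \<in> I" for i
          using that d c by (simp add: e'_def)
        moreover have "e' $ i \<le> 0" if "i \<notin> I" for i
          using that d(2)[rule_format, of i] K[of i] by (simp add: e'_def)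
        ultimately have "\<forall>i\<in>I'. e' $ i = 0" "\<forall>i. i \<notin> I' \<longrightarrow> e' $ i \<le> 0"
          using u by (metis subsetD, metis)
        moreover have "apt_pt UNIV (x + d) = apt_pt UNIV (u + e')"
          by (auto simp: apt_pt_eq_iff e'_def)
        ultimately show "apt_pt UNIV (x + d) \<in> s"
          unfolding 2 corner_nhd_eq using u by blast
      qed
    qed
  qed
qed

text \<open>This is the density of the apartment: an open set around a boundary point contains the
  far end of the cone leading to it.\<close>

lemma corner_meets_apartment:
  assumes "openin compact_apartment_topology W" "W \<noteq> {}"
  shows "W \<inter> apartment \<noteq> {}"
proof -
  obtain P where P: "P \<in> W" using assms by blast
  then have "P \<in> compact_apartment"
    using openin_subset[OF assms(1)] by auto
  then obtain I x where Ix: "P = apt_pt I x" by (rule compact_apartmentE)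
  then obtain K where "\<And>d. (\<forall>i\<in>I. d $ i = 0) \<Longrightarrow> (\<forall>i. i \<notin> I \<longrightarrow> d $ i \<le> - K) \<Longrightarrow> apt_pt UNIV (x + d) \<in> W"
    using corner_limit[OF assms(1)] P by blast
  from this[of "\<chi> i. if i \<in> I then 0 else - K"] show ?thesis
    using apt_pt_in_apartment by fastforce
qed

text \<open>On the way to the stratum of I the coordinates outside I tend to -infinity. If j is one
  of them, its coordinate can fall faster than that of i and a_ij becomes arbitrarily large; if only
  i is, a_ij tends to -infinity; if both lie in I, the difference survives in the limit.\<close>

lemma apt_pt_in_closure_root_halfspace:
  assumes "I \<noteq> {}" "i \<noteq> j"
  shows "apt_pt I x \<in> compact_apartment_topology closure_of root_halfspace i j s \<longleftrightarrow>
    j \<notin> I \<or> i \<in> I \<and> s \<le> x $ i - x $ j" (is "?L \<longleftrightarrow> ?R")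
proof
  assume R: ?R
  have "\<exists>P. P \<in> root_halfspace i j s \<and> P \<in> W"
    if W: "apt_pt I x \<in> W" "openin compact_apartment_topology W" for W
  proof -
    obtain K where K: "\<And>d. (\<forall>i\<in>I. d $ i = 0) \<Longrightarrow> (\<forall>i. i \<notin> I \<longrightarrow> d $ i \<le> - K) \<Longrightarrow> apt_pt UNIV (x + d) \<in> W"
      using corner_limit[OF W(2,1)] by blast
    define k where "k = \<bar>K\<bar> + \<bar>s\<bar> + \<bar>x $ i - x $ j\<bar>"
    \<comment> \<open>For j outside I, lowering coordinate j twice as much as the others gains at
      least k in z_i - z_j. The size of k ensures both that W is reached and that the half-space
      is.\<close>
    define d where "d = (\<chi> l. if l \<in> I then 0 else if l = j then - 2 * k else - k)"
    have k: "K \<le> k" "0 \<le> k" "s \<le> x $ i - x $ j + k"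
      unfolding k_def by linarith+
    have "apt_pt UNIV (x + d) \<in> W"
      by (rule K) (use k in \<open>auto simp: d_def\<close>)
    moreover have "s \<le> (x + d) $ i - (x + d) $ j"
      using R assms k by (auto simp: d_def)
    ultimately show ?thesis
      unfolding root_halfspace_def by blast
  qed
  then show ?L
    using assms by (auto simp: in_closure_of)
next
  assume L: ?L
  show ?R
  proof (rule ccontr)
    assume "\<not> ?R"
    then have j: "j \<in> I" and i: "i \<in> I \<Longrightarrow> x $ i - x $ j < s" by auto
    \<comment> \<open>Coordinates outside I do not affect the point; the value x_j + s - 1 puts the
      representative strictly outside the half-space even if i is not in I.\<close>
    define x' where "x' = (\<chi> l. if l \<in> I then x $ l else x $ j + s - 1)"
    have x': "apt_pt I x = apt_pt I x'" "x' $ i - x' $ j < s"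
      using i j by (auto simp: apt_pt_eq_iff x'_def intro: exI[of _ 0])
    define B where "B = ball x' 1 \<inter> {z. z $ i - z $ j < s}"
    have "open B"
      unfolding B_def by (intro open_Int open_ball open_Collect_less continuous_intros)
    then obtain W where W: "openin compact_apartment_topology W" "apt_pt I x' \<in> W"
      "W \<subseteq> {apt_pt J (y + d) | J y d. I \<subseteq> J \<and> y \<in> B \<and> (\<forall>i\<in>I. d $ i = 0) \<and> (\<forall>i. d $ i \<le> 0)}"
      using ex_corner_nhd[of I B x'] x' assms(1) by (auto simp: B_def bounded_Int)
    then obtain P where P: "P \<in> root_halfspace i j s" "P \<in> W"
      using L unfolding in_closure_of x'(1) by blast
    then obtain z where z: "P = apt_pt UNIV z" "s \<le> z $ i - z $ j"
      by (auto simp: root_halfspace_def)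
    obtain J y d where *: "apt_pt UNIV z = apt_pt J (y + d)" "y \<in> B" "\<forall>i\<in>I. d $ i = 0" "\<forall>i. d $ i \<le> 0"
      using P(2) W(3) z(1) by blast
    then obtain c where "\<And>i. z $ i = y $ i + d $ i + c"
      by (auto simp: apt_pt_eq_iff)
    \<comment> \<open>As j lies in I, d vanishes at j, so that d_i <= 0 can only lower the
      root.\<close>
    then have "z $ i - z $ j = y $ i + d $ i - y $ j"
      using * j by simp
    moreover have "d $ i \<le> 0" "y $ i - y $ j < s" using * by (auto simp: B_def)
    ultimately show False using z(2) by linarith
  qed
qed

text \<open>The admissible t form all of the reals for j outside I, the empty set for j in I and i
  outside I, and the ray t >= x_j - x_i otherwise.\<close>

lemma root_bound_apt_pt:
  assumes "I \<noteq> {}" "i \<noteq> j"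
  shows "root_bound (apt_pt I x) i j = (if j \<notin> I then - \<infinity> else if i \<notin> I then \<infinity> else ereal (x $ j - x $ i))"
proof -
  have eq: "root_bound (apt_pt I x) i j = Inf (ereal ` {t. j \<notin> I \<or> i \<in> I \<and> - t \<le> x $ i - x $ j})"
    unfolding root_bound_def apt_pt_in_closure_root_halfspace[OF assms] by (simp add: setcompr_eq_image)
  show ?thesis
  proof (cases "j \<in> I")
    case False
    have "Inf (range ereal) = - \<infinity>"
    proof (rule ereal_bot)
      show "Inf (range ereal) \<le> ereal B" for B by (rule Inf_lower) simp
    qed
    then show ?thesis using False eq by simp
  next
    case j: True
    show ?thesis
    proof (cases "i \<in> I")
      case True
      have "Inf (ereal ` {t. - t \<le> x $ i - x $ j}) = ereal (x $ j - x $ i)"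
      proof (rule antisym)
        show "Inf (ereal ` {t. - t \<le> x $ i - x $ j}) \<le> ereal (x $ j - x $ i)"
          by (rule Inf_lower) simp
        show "ereal (x $ j - x $ i) \<le> Inf (ereal ` {t. - t \<le> x $ i - x $ j})"
          by (rule Inf_greatest) auto
      qed
      then show ?thesis using True j eq by simp
    next
      case False
      then show ?thesis using j eq by (simp add: top_ereal_def)
    qed
  qed
qed

section \<open>The action of the monomial group\<close>

text \<open>A real-valued form of v for nonzero arguments. For a normalized valuation its value at 0
  is the default \<open>real_of_ereal \<infinity> = 0\<close>, hence the nonvanishing hypotheses in
  its rules.\<close>

definition rval :: "('k::field \<Rightarrow> ereal) \<Rightarrow> 'k \<Rightarrow> real" where
  "rval v a = real_of_ereal (v a)"

lemma normalized_valuation_zero: "normalized_valuation v \<Longrightarrow> v 0 = \<infinity>"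
  by (simp add: normalized_valuation_def)

lemma normalized_valuation_eq_rval: "normalized_valuation v \<Longrightarrow> a \<noteq> 0 \<Longrightarrow> v a = ereal (rval v a)"
  unfolding normalized_valuation_def rval_def by (metis real_of_ereal.simps(1))

lemma rval_mult:
  assumes "normalized_valuation v" "a \<noteq> 0" "b \<noteq> 0"
  shows "rval v (a * b) = rval v a + rval v b"
proof -
  have "v (a * b) = v a + v b"
    using assms(1) unfolding normalized_valuation_def by blast
  then show ?thesis
    using assms normalized_valuation_eq_rval[OF assms(1)] by simp
qed

lemma rval_one:
  assumes "normalized_valuation v"
  shows "rval v 1 = 0"
  using rval_mult[OF assms, of 1 1] by simp

lemma rval_divide:
  assumes "normalized_valuation v" "a \<noteq> 0" "b \<noteq> 0"
  shows "rval v (a / b) = rval v a - rval v b"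
  using rval_mult[OF assms(1), of "a / b" b] assms by simp

section \<open>The action nu in terms of coordinate vectors\<close>

lemma perm_act_apt_pt:
  assumes "bij w"
  shows "perm_act w (apt_pt I x) = apt_pt (w ` I) (\<chi> i. x $ inv_into UNIV w i)"
proof -
  have [simp]: "inv_into UNIV w (w i) = i" "w (inv_into UNIV w i) = i" for i
    using assms by (simp_all add: bij_is_inj bij_is_surj surj_f_inv_f)
  have "(\<lambda>y. \<chi> i. y $ inv_into UNIV w i) ` {y. \<exists>c. \<forall>i\<in>I. y $ i = x $ i + c} =
      {y. \<exists>c. \<forall>i\<in>w ` I. y $ i = (\<chi> i. x $ inv_into UNIV w i) $ i + c}" (is "?f ` ?A = ?B")
  proof
    show "?f ` ?A \<subseteq> ?B" by auto
    show "?B \<subseteq> ?f ` ?A"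
    proof
      fix y assume "y \<in> ?B"
      then have "(\<chi> i. y $ w i) \<in> ?A" by auto
      moreover have "y = ?f (\<chi> i. y $ w i)" by (simp add: vec_eq_iff)
      ultimately show "y \<in> ?f ` ?A" by (rule rev_image_eqI)
    qed
  qed
  then show ?thesis by (simp add: perm_act_def apt_pt_def)
qed

lemma torus_act_apt_pt: "torus_act v t (apt_pt I x) = apt_pt I (\<chi> i. x $ i - rval v (t i))"
proof -
  have "(\<lambda>y. \<chi> i. y $ i - rval v (t i)) ` {y. \<exists>c. \<forall>i\<in>I. y $ i = x $ i + c} =
      {y. \<exists>c. \<forall>i\<in>I. y $ i = (\<chi> i. x $ i - rval v (t i)) $ i + c}" (is "?f ` ?A = ?B")
  proof
    show "?f ` ?A \<subseteq> ?B" by auto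
    show "?B \<subseteq> ?f ` ?A"
    proof
      fix y assume "y \<in> ?B"
      then have "(\<chi> i. y $ i + rval v (t i)) \<in> ?A" by auto
      moreover have "y = ?f (\<chi> i. y $ i + rval v (t i))" by (simp add: vec_eq_iff)
      ultimately show "y \<in> ?f ` ?A" by (rule rev_image_eqI)
    qed
  qed
  then show ?thesis by (simp add: torus_act_def apt_pt_def rval_def)
qed

text \<open>Another representation of the same element multiplies t by a scalar c; this shifts all
  coordinates by -v(c), which \<open>apt_pt\<close> does not see. Hence the description under
  \<open>THE\<close> is unique.\<close>

lemma nu_monomial:
  assumes v: "normalized_valuation v" and t: "\<And>i. t i \<noteq> 0" and w: "bij w"
  shows "nu v (to_PGL (monomial_matrix t w)) (apt_pt I x) =
    apt_pt (w ` I) (\<chi> i. x $ inv_into UNIV w i - rval v (t i))"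
  unfolding nu_def diagonal_mult_permutation
proof (rule the_equality)
  show "\<exists>s u. (\<forall>i. s i \<noteq> 0) \<and> bij u \<and> to_PGL (monomial_matrix t w) = to_PGL (monomial_matrix s u) \<and>
      apt_pt (w ` I) (\<chi> i. x $ inv_into UNIV w i - rval v (t i)) = torus_act v s (perm_act u (apt_pt I x))"
    using t w by (intro exI[of _ t] exI[of _ w]) (simp add: perm_act_apt_pt torus_act_apt_pt)
next
  fix Q assume "\<exists>s u. (\<forall>i. s i \<noteq> 0) \<and> bij u \<and> to_PGL (monomial_matrix t w) = to_PGL (monomial_matrix s u) \<and>
      Q = torus_act v s (perm_act u (apt_pt I x))"
  then obtain s u where su: "\<And>i. s i \<noteq> 0" "bij u" "to_PGL (monomial_matrix t w) = to_PGL (monomial_matrix s u)"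
    and Q: "Q = torus_act v s (perm_act u (apt_pt I x))"
    by blast
  obtain c where c: "c \<noteq> 0" "u = w" "s = (\<lambda>i. c * t i)"
    using to_PGL_monomial_eqD[OF su(3) t su(1) w su(2)] by blast
  then have "Q = apt_pt (w ` I) (\<chi> i. x $ inv_into UNIV w i - (rval v c + rval v (t i)))"
    using Q w t v by (simp add: perm_act_apt_pt torus_act_apt_pt rval_mult)
  then show "Q = apt_pt (w ` I) (\<chi> i. x $ inv_into UNIV w i - rval v (t i))"
    by (auto simp: apt_pt_eq_iff intro!: exI[of _ "- rval v c"])
qed

lemma nu_one:
  assumes "normalized_valuation v" "P \<in> compact_apartment"
  shows "nu v \<one>\<^bsub>PGL\<^esub> P = P"
proof -
  obtain I x where "P = apt_pt I x" using assms(2) by (rule compact_apartmentE)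
  then show ?thesis
    using nu_monomial[OF assms(1), of "\<lambda>_. 1" id I x]
    by (simp add: one_PGL monomial_matrix_id rval_one[OF assms(1)] vec_lambda_eta)
qed

lemma nu_mult:
  assumes v: "normalized_valuation v" and "m \<in> monomial_group" "n \<in> monomial_group" "P \<in> compact_apartment"
  shows "nu v (m \<otimes>\<^bsub>PGL\<^esub> n) P = nu v m (nu v n P)"
proof -
  obtain I x where P: "P = apt_pt I x" using assms(4) by (rule compact_apartmentE)
  obtain t w where m: "\<And>i. t i \<noteq> 0" "bij w" "m = to_PGL (monomial_matrix t w)"
    using assms(2) by (rule monomial_groupE) blast
  obtain s u where n: "\<And>i. s i \<noteq> 0" "bij u" "n = to_PGL (monomial_matrix s u)"
    using assms(3) by (rule monomial_groupE) blast
  have "m \<otimes>\<^bsub>PGL\<^esub> n = to_PGL (monomial_matrix (\<lambda>k. t k * s (inv_into UNIV w k)) (w \<circ> u))"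
    using m n by (simp add: invertible_monomial_matrix monomial_matrix_mult_monomial)
  moreover have "inv_into UNIV (w \<circ> u) = inv_into UNIV u \<circ> inv_into UNIV w"
    using m n by (simp add: o_inv_distrib)
  ultimately show ?thesis
    using m n v P
    by (simp add: nu_monomial bij_comp rval_mult image_comp) (simp add: algebra_simps)
qed

lemma nu_closed:
  assumes "normalized_valuation v" "n \<in> monomial_group" "P \<in> compact_apartment"
  shows "nu v n P \<in> compact_apartment"
  using assms by (auto elim!: monomial_groupE compact_apartmentE simp: nu_monomial)

text \<open>The permutation part moves the stratum of I to that of w(I), and w(I) is the full index
  set only if I is.\<close>

lemma nu_in_apartment_iff:
  assumes "normalized_valuation v" "n \<in> monomial_group" "P \<in> compact_apartment"
  shows "nu v n P \<in> apartment \<longleftrightarrow> P \<in> apartment"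
proof -
  obtain I x where P: "P = apt_pt I x" using assms(3) by (rule compact_apartmentE)
  obtain t w where n: "\<And>i. t i \<noteq> 0" "bij w" "n = to_PGL (monomial_matrix t w)"
    using assms(2) by (rule monomial_groupE) blast
  have "w ` I = UNIV \<longleftrightarrow> I = UNIV"
    using n(2) by (metis bij_def inj_image_eq_iff)
  then show ?thesis
    using n P assms(1) by (simp add: nu_monomial)
qed

section \<open>The stabilizer groups\<close>

lemma root_subgroupE:
  assumes "g \<in> root_subgroup v x i j"
  obtains \<omega> where "root_bound x i j \<le> v \<omega>" "g = to_PGL (root_matrix i j \<omega>)"
  using assms by (auto simp: root_subgroup_def)

lemma root_subgroups_closed:
  "(\<Union>(i, j)\<in>{(i, j). i \<noteq> j}. root_subgroup v x i j) \<subseteq> carrier PGL"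
  by (auto simp: root_subgroup_def invertible_root_matrix)

lemma subgroup_U_stab: "subgroup (U_stab v x) PGL"
  unfolding U_stab_def by (rule PGL.generate_is_subgroup[OF root_subgroups_closed])

lemma root_matrix_in_U_stab:
  "i \<noteq> j \<Longrightarrow> root_bound x i j \<le> v \<omega> \<Longrightarrow> to_PGL (root_matrix i j \<omega>) \<in> U_stab v x"
  unfolding U_stab_def by (rule generate.incl) (auto simp: root_subgroup_def)

lemma U_stab_closed [simp]: "h \<in> U_stab v x \<Longrightarrow> h \<in> carrier PGL"
  using subgroup.mem_carrier[OF subgroup_U_stab] .

lemma monomial_group_closed [simp]: "n \<in> monomial_group \<Longrightarrow> n \<in> carrier PGL"
  using subgroup.mem_carrier[OF subgroup_monomial_group] .

text \<open>For i, j in I both sides change by v(t_{w i}) - v(t_{w j}), since coordinate w i of the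
  image point is x_i - v(t_{w i}). Infinite bounds are transported because w maps I to w(I), and the
  parameter 0 meets every bound.\<close>

lemma root_bound_nu:
  fixes \<omega> :: "'k::field"
  assumes v: "normalized_valuation v" and t: "\<And>i. t i \<noteq> 0" and w: "bij w" and ij: "i \<noteq> j" and I: "I \<noteq> {}"
    and le: "root_bound (apt_pt I x) i j \<le> v \<omega>"
  shows "root_bound (nu v (to_PGL (monomial_matrix t w)) (apt_pt I x)) (w i) (w j) \<le> v (\<omega> * t (w i) / t (w j))"
proof (cases "\<omega> = 0")
  case True
  then show ?thesis using v by (simp add: normalized_valuation_zero)
next
  case False
  have inj: "inj w" using w by (rule bij_is_inj)
  then have [simp]: "w i \<noteq> w j" "w i \<in> w ` I \<longleftrightarrow> i \<in> I" "w j \<in> w ` I \<longleftrightarrow> j \<in> I"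
    "inv_into UNIV w (w i) = i" "inv_into UNIV w (w j) = j"
    using ij by (auto simp: inj_eq inj_image_mem_iff)
  show ?thesis
    using le False t I ij
    by (auto simp: nu_monomial[OF v t w] root_bound_apt_pt normalized_valuation_eq_rval[OF v] rval_mult[OF v]
        rval_divide[OF v] split: if_splits)
qed

text \<open>It suffices to conjugate generators, where \<open>monomial_conj_root_matrix\<close>
  gives the new transvection and \<open>root_bound_nu\<close> its bound.\<close>

lemma U_stab_conj:
  assumes v: "normalized_valuation v" and n: "n \<in> monomial_group" and P: "P \<in> compact_apartment"
    and h: "h \<in> U_stab v P"
  shows "n \<otimes>\<^bsub>PGL\<^esub> h \<otimes>\<^bsub>PGL\<^esub> inv\<^bsub>PGL\<^esub> n \<in> U_stab v (nu v n P)"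
proof -
  obtain t w where tw: "\<And>i. t i \<noteq> 0" "bij w" "n = to_PGL (monomial_matrix t w)"
    using n by (rule monomial_groupE) blast
  obtain I x where Ix: "I \<noteq> {}" "P = apt_pt I x" using P by (rule compact_apartmentE)
  note [simp] = monomial_group_closed[OF n]
  have gen: "n \<otimes>\<^bsub>PGL\<^esub> r \<otimes>\<^bsub>PGL\<^esub> inv\<^bsub>PGL\<^esub> n \<in> U_stab v (nu v n P)"
    if r: "r \<in> root_subgroup v P i j" and ij: "i \<noteq> j" for r i j
  proof -
    from r obtain \<omega> where \<omega>: "root_bound P i j \<le> v \<omega>" "r = to_PGL (root_matrix i j \<omega>)"
      by (rule root_subgroupE)
    let ?r = "to_PGL (root_matrix (w i) (w j) (\<omega> * t (w i) / t (w j)))"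
    have wij: "w i \<noteq> w j" using tw(2) ij by (simp add: bij_is_inj inj_eq)
    have "n \<otimes>\<^bsub>PGL\<^esub> r = ?r \<otimes>\<^bsub>PGL\<^esub> n"
      using tw ij wij \<omega> by (simp add: invertible_monomial_matrix invertible_root_matrix monomial_conj_root_matrix)
    then have "n \<otimes>\<^bsub>PGL\<^esub> r \<otimes>\<^bsub>PGL\<^esub> inv\<^bsub>PGL\<^esub> n = ?r"
      using wij by (simp add: PGL.m_assoc invertible_root_matrix)
    moreover have "?r \<in> U_stab v (nu v n P)"
      using root_bound_nu[OF v tw(1,2) ij Ix(1)] \<omega>(1) Ix(2) tw(3) wij by (intro root_matrix_in_U_stab) auto
    ultimately show ?thesis by simp
  qed
  note sub = subgroup_U_stab[of v "nu v n P"]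
  show ?thesis
    using h unfolding U_stab_def[of v P]
  proof induction
    case one
    show ?case using subgroup.one_closed[OF sub] by simp
  next
    case (incl r)
    then show ?case using gen by blast
  next
    case (inv r)
    then have "inv\<^bsub>PGL\<^esub> (n \<otimes>\<^bsub>PGL\<^esub> r \<otimes>\<^bsub>PGL\<^esub> inv\<^bsub>PGL\<^esub> n) \<in> U_stab v (nu v n P)"
      using gen subgroup.m_inv_closed[OF sub] by blast
    moreover have "r \<in> carrier PGL" using inv root_subgroups_closed by blast
    ultimately show ?case by (simp add: PGL.inv_mult_group PGL.m_assoc)
  next
    case (eng h1 h2)
    then have c: "h1 \<in> carrier PGL" "h2 \<in> carrier PGL"
      using PGL.generate_in_carrier[OF root_subgroups_closed] by blast+
    have "(n \<otimes>\<^bsub>PGL\<^esub> h1 \<otimes>\<^bsub>PGL\<^esub> inv\<^bsub>PGL\<^esub> n) \<otimes>\<^bsub>PGL\<^esub> (n \<otimes>\<^bsub>PGL\<^esub> h2 \<otimes>\<^bsub>PGL\<^esub> inv\<^bsub>PGL\<^esub> n) \<in> U_stab v (nu v n P)"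
      using eng subgroup.m_closed[OF sub] by blast
    then show ?case using c by (simp add: PGL.m_assoc PGL.inv_solve_left' flip: PGL.m_assoc[of "inv\<^bsub>PGL\<^esub> n"])
  qed
qed

section \<open>The groups N_x and P_x\<close>

lemma N_stabD: "m \<in> N_stab v P \<Longrightarrow> m \<in> monomial_group \<and> nu v m P = P"
  by (simp add: N_stab_def)

lemma subgroup_N_stab:
  assumes v: "normalized_valuation v" and P: "P \<in> compact_apartment"
  shows "subgroup (N_stab v P) PGL"
proof (rule PGL.subgroupI)
  show "N_stab v P \<subseteq> carrier PGL" by (auto simp: N_stab_def)
  show "N_stab v P \<noteq> {}"
    using subgroup.one_closed[OF subgroup_monomial_group] nu_one[OF v P] by (auto simp: N_stab_def)
  fix m assume m: "m \<in> N_stab v P"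
  then have *: "m \<in> monomial_group" "inv\<^bsub>PGL\<^esub> m \<in> monomial_group" "nu v m P = P"
    using subgroup.m_inv_closed[OF subgroup_monomial_group] by (auto simp: N_stab_def)
  then have "nu v (inv\<^bsub>PGL\<^esub> m) P = P"
    using nu_mult[OF v *(2,1) P] nu_one[OF v P] by simp
  with * show "inv\<^bsub>PGL\<^esub> m \<in> N_stab v P" by (simp add: N_stab_def)
  fix n assume "n \<in> N_stab v P"
  then show "m \<otimes>\<^bsub>PGL\<^esub> n \<in> N_stab v P"
    using m subgroup.m_closed[OF subgroup_monomial_group] nu_mult[OF v _ _ P] by (auto simp: N_stab_def)
qed

lemma P_stabI: "u \<in> U_stab v P \<Longrightarrow> m \<in> N_stab v P \<Longrightarrow> u \<otimes>\<^bsub>PGL\<^esub> m \<in> P_stab v P"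
  by (auto simp: P_stab_def set_mult_def)

lemma P_stabE:
  assumes "h \<in> P_stab v P"
  obtains u m where "u \<in> U_stab v P" "m \<in> N_stab v P" "h = u \<otimes>\<^bsub>PGL\<^esub> m"
  using assms by (auto simp: P_stab_def set_mult_def)

lemma U_stab_subset_P_stab:
  assumes "normalized_valuation v" "P \<in> compact_apartment"
  shows "U_stab v P \<subseteq> P_stab v P"
  using P_stabI[OF _ subgroup.one_closed[OF subgroup_N_stab[OF assms]]] by fastforce

text \<open>Elements of N_x fix x and hence, by \<open>U_stab_conj\<close>, normalize U_x; this
  makes U_x N_x closed under products and inverses.\<close>

lemma subgroup_P_stab:
  assumes v: "normalized_valuation v" and P: "P \<in> compact_apartment"
  shows "subgroup (P_stab v P) PGL"
proof (rule PGL.subgroupI)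
  note U = subgroup_U_stab[of v P] and N = subgroup_N_stab[OF v P]
  have closed [simp]: "m \<in> carrier PGL" if "m \<in> N_stab v P" for m
    using that by (simp add: N_stab_def)
  show "P_stab v P \<subseteq> carrier PGL" by (auto elim!: P_stabE)
  show "P_stab v P \<noteq> {}"
    using P_stabI[OF subgroup.one_closed[OF U] subgroup.one_closed[OF N]] by blast
  fix h assume "h \<in> P_stab v P"
  then obtain u m where h: "u \<in> U_stab v P" "m \<in> N_stab v P" "h = u \<otimes>\<^bsub>PGL\<^esub> m"
    by (rule P_stabE)
  have m': "inv\<^bsub>PGL\<^esub> m \<in> N_stab v P" using subgroup.m_inv_closed[OF N] h by blast
  then have "inv\<^bsub>PGL\<^esub> m \<otimes>\<^bsub>PGL\<^esub> inv\<^bsub>PGL\<^esub> u \<otimes>\<^bsub>PGL\<^esub> inv\<^bsub>PGL\<^esub> (inv\<^bsub>PGL\<^esub> m) \<in> U_stab v P"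
    using U_stab_conj[OF v _ P, of "inv\<^bsub>PGL\<^esub> m" "inv\<^bsub>PGL\<^esub> u"] subgroup.m_inv_closed[OF U] h N_stabD by metis
  from P_stabI[OF this m'] show "inv\<^bsub>PGL\<^esub> h \<in> P_stab v P"
    using h by (simp add: PGL.inv_mult_group PGL.m_assoc)
  fix g assume "g \<in> P_stab v P"
  then obtain u' m' where g: "u' \<in> U_stab v P" "m' \<in> N_stab v P" "g = u' \<otimes>\<^bsub>PGL\<^esub> m'"
    by (rule P_stabE)
  have "m \<otimes>\<^bsub>PGL\<^esub> u' \<otimes>\<^bsub>PGL\<^esub> inv\<^bsub>PGL\<^esub> m \<in> U_stab v P"
    using U_stab_conj[OF v _ P, of m u'] h g N_stabD by metis
  then have "(u \<otimes>\<^bsub>PGL\<^esub> (m \<otimes>\<^bsub>PGL\<^esub> u' \<otimes>\<^bsub>PGL\<^esub> inv\<^bsub>PGL\<^esub> m)) \<otimes>\<^bsub>PGL\<^esub> (m \<otimes>\<^bsub>PGL\<^esub> m') \<in> P_stab v P"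
    using h g subgroup.m_closed[OF U] subgroup.m_closed[OF N] by (intro P_stabI) auto
  moreover have "(u \<otimes>\<^bsub>PGL\<^esub> (m \<otimes>\<^bsub>PGL\<^esub> u' \<otimes>\<^bsub>PGL\<^esub> inv\<^bsub>PGL\<^esub> m)) \<otimes>\<^bsub>PGL\<^esub> (m \<otimes>\<^bsub>PGL\<^esub> m') = h \<otimes>\<^bsub>PGL\<^esub> g"
    using h g by (simp add: PGL.m_assoc) (simp flip: PGL.m_assoc)
  ultimately show "h \<otimes>\<^bsub>PGL\<^esub> g \<in> P_stab v P" by simp
qed

lemma P_stab_conj:
  assumes v: "normalized_valuation v" and n: "n \<in> monomial_group" and P: "P \<in> compact_apartment"
    and h: "h \<in> P_stab v P"
  shows "n \<otimes>\<^bsub>PGL\<^esub> h \<otimes>\<^bsub>PGL\<^esub> inv\<^bsub>PGL\<^esub> n \<in> P_stab v (nu v n P)"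
proof -
  obtain u m where um: "u \<in> U_stab v P" "m \<in> N_stab v P" "h = u \<otimes>\<^bsub>PGL\<^esub> m"
    using h by (rule P_stabE)
  have m: "m \<in> monomial_group" "nu v m P = P" using um N_stabD by blast+
  have n': "inv\<^bsub>PGL\<^esub> n \<in> monomial_group" using n subgroup.m_inv_closed[OF subgroup_monomial_group] by blast
  note mult = subgroup.m_closed[OF subgroup_monomial_group]
  have "nu v (inv\<^bsub>PGL\<^esub> n) (nu v n P) = P"
    using nu_mult[OF v n' n P] nu_one[OF v P] n by simp
  then have "nu v (n \<otimes>\<^bsub>PGL\<^esub> m \<otimes>\<^bsub>PGL\<^esub> inv\<^bsub>PGL\<^esub> n) (nu v n P) = nu v n P"
    using nu_mult[OF v mult[OF n m(1)] n' nu_closed[OF v n P]] nu_mult[OF v n m(1) P] m by simp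
  then have "n \<otimes>\<^bsub>PGL\<^esub> m \<otimes>\<^bsub>PGL\<^esub> inv\<^bsub>PGL\<^esub> n \<in> N_stab v (nu v n P)"
    using mult[OF mult[OF n m(1)] n'] by (simp add: N_stab_def)
  from P_stabI[OF U_stab_conj[OF v n P um(1)] this]
  show ?thesis
    using um m n by (simp add: PGL.m_assoc) (simp flip: PGL.m_assoc)
qed

section \<open>Gaussian elimination\<close>

lemma rval_minus:
  assumes "normalized_valuation v" "a \<noteq> 0"
  shows "rval v (- a) = rval v a"
proof -
  have "rval v (-1) + rval v (-1) = rval v 1"
    using rval_mult[OF assms(1), of "-1" "-1"] by simp
  then have "rval v (-1) = 0"
    using rval_one[OF assms(1)] by simp
  then show ?thesis
    using rval_mult[OF assms(1), of "-1" a] assms(2) by simp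
qed

text \<open>Row k is not in S and never changes, so the operations can be done one after another
  with the original coefficients. Invertibility is carried through the induction because
  \<open>to_PGL_mult\<close> asks for it.\<close>

lemma row_operations:
  fixes A :: "'k::field^'n::finite^'n"
  assumes H: "subgroup H PGL" and A: "invertible A"
    and S: "finite S" "k \<notin> S" and c: "\<And>l. l \<in> S \<Longrightarrow> to_PGL (root_matrix l k (c l)) \<in> H"
  shows "invertible (\<chi> l j. if l \<in> S then A $ l $ j + c l * A $ k $ j else A $ l $ j) \<and>
    (\<exists>h\<in>H. to_PGL (\<chi> l j. if l \<in> S then A $ l $ j + c l * A $ k $ j else A $ l $ j) = h \<otimes>\<^bsub>PGL\<^esub> to_PGL A)"
  using S c
proof (induction S)
  case empty
  show ?case using A subgroup.one_closed[OF H] by (auto simp: vec_lambda_eta intro!: bexI[of _ "\<one>\<^bsub>PGL\<^esub>"])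
next
  case (insert a S)
  define B where "B = (\<chi> l j. if l \<in> S then A $ l $ j + c l * A $ k $ j else A $ l $ j)"
  obtain h where h: "invertible B" "h \<in> H" "to_PGL B = h \<otimes>\<^bsub>PGL\<^esub> to_PGL A"
    using insert unfolding B_def by auto
  have ak: "a \<noteq> k" and R: "to_PGL (root_matrix a k (c a)) \<in> H" using insert by auto
  have "(\<chi> l j. if l \<in> insert a S then A $ l $ j + c l * A $ k $ j else A $ l $ j) = root_matrix a k (c a) ** B"
    using insert ak unfolding root_matrix_mult[OF ak] B_def by (simp add: vec_eq_iff)
  moreover have "to_PGL (root_matrix a k (c a) ** B) = to_PGL (root_matrix a k (c a)) \<otimes>\<^bsub>PGL\<^esub> h \<otimes>\<^bsub>PGL\<^esub> to_PGL A"
    using h ak A subgroup.mem_carrier[OF H] by (simp add: PGL.m_assoc invertible_root_matrix flip: to_PGL_mult)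
  ultimately show ?case
    using subgroup.m_closed[OF H R h(2)] h(1) ak by (auto simp: invertible_mult invertible_root_matrix)
qed

text \<open>The mirror image of \<open>row_operations\<close>: column i is the unchanged one, and H
  acts from the right.\<close>

lemma column_operations:
  fixes A :: "'k::field^'n::finite^'n"
  assumes H: "subgroup H PGL" and A: "invertible A"
    and S: "finite S" "i \<notin> S" and c: "\<And>j. j \<in> S \<Longrightarrow> to_PGL (root_matrix i j (c j)) \<in> H"
  shows "invertible (\<chi> l j. if j \<in> S then A $ l $ j + c j * A $ l $ i else A $ l $ j) \<and>
    (\<exists>h\<in>H. to_PGL (\<chi> l j. if j \<in> S then A $ l $ j + c j * A $ l $ i else A $ l $ j) = to_PGL A \<otimes>\<^bsub>PGL\<^esub> h)"
  using S c
proof (induction S)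
  case empty
  show ?case using A subgroup.one_closed[OF H] by (auto simp: vec_lambda_eta intro!: bexI[of _ "\<one>\<^bsub>PGL\<^esub>"])
next
  case (insert a S)
  define B where "B = (\<chi> l j. if j \<in> S then A $ l $ j + c j * A $ l $ i else A $ l $ j)"
  obtain h where h: "invertible B" "h \<in> H" "to_PGL B = to_PGL A \<otimes>\<^bsub>PGL\<^esub> h"
    using insert unfolding B_def by auto
  have ia: "i \<noteq> a" and R: "to_PGL (root_matrix i a (c a)) \<in> H" using insert by auto
  have "(\<chi> l j. if j \<in> insert a S then A $ l $ j + c j * A $ l $ i else A $ l $ j) = B ** root_matrix i a (c a)"
    using insert ia unfolding mult_root_matrix[OF ia] B_def by (simp add: vec_eq_iff)
  moreover have "to_PGL (B ** root_matrix i a (c a)) = to_PGL A \<otimes>\<^bsub>PGL\<^esub> (h \<otimes>\<^bsub>PGL\<^esub> to_PGL (root_matrix i a (c a)))"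
    using h ia A subgroup.mem_carrier[OF H] by (simp add: PGL.m_assoc invertible_root_matrix flip: to_PGL_mult)
  ultimately show ?case
    using subgroup.m_closed[OF H h(2) R] h(1) ia by (auto simp: invertible_mult invertible_root_matrix)
qed

text \<open>The columns with a pivot isolated in both its row and its column. The number of the
  other columns is the termination measure of the elimination.\<close>

definition cleared :: "'k::field^'n::finite^'n \<Rightarrow> 'n set" where
  "cleared A = {i. \<exists>k. A $ k $ i \<noteq> 0 \<and> (\<forall>l. l \<noteq> i \<longrightarrow> A $ k $ l = 0) \<and> (\<forall>l. l \<noteq> k \<longrightarrow> A $ l $ i = 0)}"

text \<open>Earlier progress is kept: the row of an isolated pivot is zero in column i, its column
  is zero in row k, so neither kind of operation touches them.\<close>

lemma clear_pivot:
  fixes A :: "'k::field^'n::finite^'n"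
  assumes L: "subgroup L PGL" and R: "subgroup R PGL" and A: "invertible A"
    and piv: "A $ k $ i \<noteq> 0" "i \<notin> cleared A"
    and rows: "\<And>l. l \<noteq> k \<Longrightarrow> to_PGL (root_matrix l k (- A $ l $ i / A $ k $ i)) \<in> L"
    and cols: "\<And>j. j \<noteq> i \<Longrightarrow> to_PGL (root_matrix i j (- A $ k $ j / A $ k $ i)) \<in> R"
  obtains B u h where "invertible B" "insert i (cleared A) \<subseteq> cleared B"
    "u \<in> L" "h \<in> R" "to_PGL B = u \<otimes>\<^bsub>PGL\<^esub> to_PGL A \<otimes>\<^bsub>PGL\<^esub> h"
proof -
  define A1 where "A1 = (\<chi> l j. if l \<in> UNIV - {k} then A $ l $ j + (- A $ l $ i / A $ k $ i) * A $ k $ j else A $ l $ j)"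
  define B where "B = (\<chi> l j. if j \<in> UNIV - {i} then A1 $ l $ j + (- A $ k $ j / A $ k $ i) * A1 $ l $ i else A1 $ l $ j)"
  obtain u where A1: "invertible A1" "u \<in> L" "to_PGL A1 = u \<otimes>\<^bsub>PGL\<^esub> to_PGL A"
    using row_operations[OF L A, of "UNIV - {k}" k "\<lambda>l. - A $ l $ i / A $ k $ i"] rows
    unfolding A1_def by auto
  obtain h where B: "invertible B" "h \<in> R" "to_PGL B = to_PGL A1 \<otimes>\<^bsub>PGL\<^esub> h"
    using column_operations[OF R A1(1), of "UNIV - {i}" i "\<lambda>j. - A $ k $ j / A $ k $ i"] cols
    unfolding B_def by auto
  \<comment> \<open>Outside the pivot row and column this is the Schur complement of the
    pivot.\<close>
  have entry: "B $ l $ j = (if l = k then (if j = i then A $ k $ i else 0) else if j = i then 0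
      else A $ l $ j - A $ l $ i * A $ k $ j / A $ k $ i)" for l j
    using piv by (auto simp: B_def A1_def)
  have "i \<in> cleared B"
    unfolding cleared_def using piv by (auto simp: entry intro!: exI[of _ k])
  moreover have "j \<in> cleared B" if j: "j \<in> cleared A" for j
  proof -
    obtain m where m: "A $ m $ j \<noteq> 0" "\<And>l. l \<noteq> j \<Longrightarrow> A $ m $ l = 0" "\<And>l. l \<noteq> m \<Longrightarrow> A $ l $ j = 0"
      using j unfolding cleared_def by blast
    have ji: "j \<noteq> i" using j piv by blast
    then have mk: "m \<noteq> k" using m(2)[of i] piv by auto
    have "A $ m $ i = 0" "A $ k $ j = 0" using m ji mk by metis+
    then show ?thesis
      unfolding cleared_def using m mk ji by (auto simp: entry intro!: exI[of _ m])
  qed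
  ultimately show thesis
    using that[OF B(1) _ A1(2) B(2)] B(3) A1(3) by auto
qed

text \<open>The rows of the isolated pivots define w; two columns cannot share such a row, and
  finiteness makes w bijective.\<close>

lemma monomial_if_all_cleared:
  fixes A :: "'k::field^'n::finite^'n"
  assumes "cleared A = UNIV"
  shows "to_PGL A \<in> monomial_group"
proof -
  have "\<forall>i. \<exists>k. A $ k $ i \<noteq> 0 \<and> (\<forall>l. l \<noteq> i \<longrightarrow> A $ k $ l = 0) \<and> (\<forall>l. l \<noteq> k \<longrightarrow> A $ l $ i = 0)"
    using assms unfolding cleared_def by blast
  then obtain w where w: "\<And>i. A $ w i $ i \<noteq> 0" "\<And>i l. l \<noteq> i \<Longrightarrow> A $ w i $ l = 0" "\<And>i l. l \<noteq> w i \<Longrightarrow> A $ l $ i = 0"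
    by metis
  have "inj w"
    using w(1,2) by (metis injI)
  then have bij: "bij w"
    by (simp add: bij_def finite_UNIV_inj_surj)
  have inv [simp]: "inv_into UNIV w (w i) = i" for i
    using \<open>inj w\<close> by simp
  have "A = monomial_matrix (\<lambda>k. A $ k $ inv_into UNIV w k) w"
    using w(3) by (auto simp: monomial_matrix_def vec_eq_iff)
  moreover have "A $ k $ inv_into UNIV w k \<noteq> 0" for k
    using w(1) bij by (metis inv bij_pointE)
  ultimately show ?thesis
    using monomial_groupI[of "\<lambda>k. A $ k $ inv_into UNIV w k" w] bij by metis
qed

text \<open>
  Choosing the pivot \<open>(k, i)\<close> with \<open>v(A\<^sub>k\<^sub>i) - x\<^sub>i\<close> minimal, columns in \<open>I\<close> first, ensures that its row
  can be cleared by column operations in \<open>U\<^sub>x\<close> and its column by integral row operations.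
\<close>

lemma ex_monomial_decomposition:
  fixes A :: "'k::field^'n::finite^'n"
  assumes v: "normalized_valuation v" and A: "invertible A" and I: "I \<noteq> {}"
  shows "\<exists>u\<in>U_stab v (apt_pt UNIV 0). \<exists>n\<in>monomial_group. \<exists>h\<in>U_stab v (apt_pt I x).
    to_PGL A = u \<otimes>\<^bsub>PGL\<^esub> n \<otimes>\<^bsub>PGL\<^esub> h"
  using A
proof (induction "card (- cleared A)" arbitrary: A rule: less_induct)
  case less
  let ?L = "U_stab v (apt_pt UNIV 0) :: ('k, 'n) pgl set" and ?R = "U_stab v (apt_pt I x) :: ('k, 'n) pgl set"
  note L = subgroup_U_stab[of v "apt_pt UNIV (0 :: real^'n)"] and R = subgroup_U_stab[of v "apt_pt I x"]
  show ?case
  proof (cases "cleared A = UNIV")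
    case True
    then show ?thesis
      using monomial_if_all_cleared[OF True] subgroup.one_closed[OF L] subgroup.one_closed[OF R] less.prems
      by (intro bexI[of _ "\<one>\<^bsub>PGL\<^esub>"] bexI[of _ "to_PGL A"]) auto
  next
    case False
    \<comment> \<open>Columns outside I become candidates only once every column in I is
      cleared.\<close>
    define S where "S = (if I \<subseteq> cleared A then - cleared A else I - cleared A)"
    have S: "S \<noteq> {}" "S \<inter> cleared A = {}"
      using False by (auto simp: S_def)
    define f where "f = (\<lambda>(k, i). v (A $ k $ i) - ereal (x $ i))"
    have fin: "finite (f ` (UNIV \<times> S))" "f ` (UNIV \<times> S) \<noteq> {}" using S(1) by auto
    then obtain k i where ki: "i \<in> S" "f (k, i) = Min (f ` (UNIV \<times> S))"
      using Min_in[OF fin] by fastforce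
    have min: "f (k, i) \<le> f (l, j)" if "j \<in> S" for l j
      unfolding ki(2) using fin(1) that by (intro Min_le) auto
    note val = normalized_valuation_eq_rval[OF v]
    \<comment> \<open>If the minimum were infinite, column i would vanish, contradicting the
      existence of a left inverse.\<close>
    have piv: "A $ k $ i \<noteq> 0"
    proof
      assume "A $ k $ i = 0"
      then have "f (k, i) = \<infinity>" using normalized_valuation_zero[OF v] by (simp add: f_def)
      then have inf: "f (l, i) = \<infinity>" for l using min[OF ki(1)] by (metis ereal_infty_less_eq(1))
      have "A $ l $ i = 0" for l
        using val[of "A $ l $ i"] inf[of l] by (cases "A $ l $ i = 0") (simp_all add: f_def)
      moreover obtain B where "B ** A = mat 1" using less.prems by (rule invertible_inverse)
      ultimately have "(mat 1 :: 'k^'n^'n) $ i $ i = 0"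
        by (auto simp: matrix_matrix_mult_def simp flip: \<open>B ** A = mat 1\<close>)
      then show False by (simp add: mat_def)
    qed
    \<comment> \<open>Within one column the weight x_i cancels, so the quotients are integral, and 0
      is the bound defining U_0.\<close>
    have rows: "to_PGL (root_matrix l k (- A $ l $ i / A $ k $ i)) \<in> ?L" if "l \<noteq> k" for l
    proof (rule root_matrix_in_U_stab[OF that])
      have "0 \<le> v (- A $ l $ i / A $ k $ i)"
      proof (cases "A $ l $ i = 0")
        case True
        then show ?thesis using normalized_valuation_zero[OF v] by simp
      next
        case False
        then show ?thesis
          using min[OF ki(1), of l] piv val by (simp add: f_def rval_divide[OF v] rval_minus[OF v])
      qed
      then show "root_bound (apt_pt UNIV 0) l k \<le> v (- A $ l $ i / A $ k $ i)"
        using that by (simp add: root_bound_apt_pt zero_ereal_def)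
    qed
    have cols: "to_PGL (root_matrix i j (- A $ k $ j / A $ k $ i)) \<in> ?R" if ji: "j \<noteq> i" for j
    proof (rule root_matrix_in_U_stab)
      show "root_bound (apt_pt I x) i j \<le> v (- A $ k $ j / A $ k $ i)"
      proof (cases "A $ k $ j = 0 \<or> j \<notin> I")
        case True
        then show ?thesis
          using ji I normalized_valuation_zero[OF v] by (auto simp: root_bound_apt_pt)
      next
        case False
        \<comment> \<open>A cleared column j with a nonzero entry in row k has its isolated pivot
          there, which would force A_ki = 0. So I is not yet exhausted and S consists of columns in
          I.\<close>
        have "j \<notin> cleared A"
          using False piv ji unfolding cleared_def by force
        then have "j \<in> S" "i \<in> I"
          using False ki(1) by (auto simp: S_def split: if_splits)
        then show ?thesis
          using min[of j k] False piv ji I val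
          by (simp add: f_def root_bound_apt_pt rval_divide[OF v] rval_minus[OF v])
      qed
    qed (use ji in simp)
    have "i \<notin> cleared A" using ki(1) S(2) by blast
    from clear_pivot[OF L R less.prems piv this rows cols]
    obtain B u h where B: "invertible B" "insert i (cleared A) \<subseteq> cleared B"
      "u \<in> ?L" "h \<in> ?R" "to_PGL B = u \<otimes>\<^bsub>PGL\<^esub> to_PGL A \<otimes>\<^bsub>PGL\<^esub> h"
      by blast
    have "- cleared B \<subset> - cleared A"
      using B(2) \<open>i \<notin> cleared A\<close> by blast
    then have "card (- cleared B) < card (- cleared A)"
      by (intro psubset_card_mono) auto
    from less.hyps[OF this B(1)] obtain u' n h' where B': "u' \<in> ?L" "n \<in> monomial_group" "h' \<in> ?R"
      "to_PGL B = u' \<otimes>\<^bsub>PGL\<^esub> n \<otimes>\<^bsub>PGL\<^esub> h'"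
      by blast
    have "to_PGL A = inv\<^bsub>PGL\<^esub> u \<otimes>\<^bsub>PGL\<^esub> to_PGL B \<otimes>\<^bsub>PGL\<^esub> inv\<^bsub>PGL\<^esub> h"
      unfolding B(5) using B(3,4) less.prems by (simp add: PGL.m_assoc) (simp flip: PGL.m_assoc)
    also have "\<dots> = (inv\<^bsub>PGL\<^esub> u \<otimes>\<^bsub>PGL\<^esub> u') \<otimes>\<^bsub>PGL\<^esub> n \<otimes>\<^bsub>PGL\<^esub> (h' \<otimes>\<^bsub>PGL\<^esub> inv\<^bsub>PGL\<^esub> h)"
      using B(3,4) B' by (simp add: PGL.m_assoc)
    finally show ?thesis
      using B(3,4) B' subgroup.m_closed[OF L] subgroup.m_inv_closed[OF L]
        subgroup.m_closed[OF R] subgroup.m_inv_closed[OF R] by blast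
  qed
qed

section \<open>The building and its compactification\<close>

lemma U_stab_subset_U0_hat:
  assumes "normalized_valuation v"
  shows "U_stab v (apt_pt UNIV 0) \<subseteq> (U0_hat v :: ('k::field, 'n::finite) pgl set)"
proof -
  have "(\<one>\<^bsub>PGL\<^esub> :: ('k, 'n) pgl) \<in> torus"
    by (auto simp: torus_def one_PGL diagonal_matrix_def mat_def intro!: exI[of _ "\<lambda>_. 1"])
  then have one: "\<one>\<^bsub>PGL\<^esub> \<in> (torus_kernel v :: ('k, 'n) pgl set)"
    using nu_one[OF assms] apartment_subset_compact_apartment unfolding torus_kernel_def by blast
  show ?thesis
  proof
    fix u :: "('k, 'n) pgl" assume u: "u \<in> U_stab v (apt_pt UNIV 0)"
    then have "u = u \<otimes>\<^bsub>PGL\<^esub> \<one>\<^bsub>PGL\<^esub>" by simp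
    with u one show "u \<in> U0_hat v"
      unfolding U0_hat_def set_mult_def by blast
  qed
qed

lemma torus_subset_monomial_group: "torus \<subseteq> monomial_group"
proof
  fix g :: "('k::field, 'n::finite) pgl" assume "g \<in> torus"
  then obtain t where t: "g = to_PGL (diagonal_matrix t)" "\<And>i. t i \<noteq> 0"
    by (auto simp: torus_def)
  moreover have "diagonal_matrix t = monomial_matrix t id"
    by (simp add: diagonal_matrix_def monomial_matrix_def)
  ultimately show "g \<in> monomial_group"
    using monomial_groupI[of t id] by simp
qed

lemma U0_hat_closed: "U0_hat v \<subseteq> carrier PGL"
  unfolding U0_hat_def torus_kernel_def set_mult_def
  using torus_subset_monomial_group monomial_group_closed U_stab_closed by (auto intro!: PGL.m_closed)

text \<open>The inclusions of U_0 in U_0^ and of U_x in P_x turn the elimination result into the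
  decomposition axiom.\<close>

lemma gluing_PGL:
  assumes v: "normalized_valuation v"
  shows "gluing (PGL :: ('k::field, 'n::finite) pgl monoid) monomial_group (nu v) compact_apartment (P_stab v) (U0_hat v)"
proof (intro gluing.intro gluing_axioms.intro group_PGL subgroup_monomial_group U0_hat_closed)
  fix g :: "('k, 'n) pgl" and P :: "'n apt_point"
  assume "g \<in> carrier PGL" "P \<in> compact_apartment"
  moreover from this obtain A I x where "invertible A" "g = to_PGL A" "I \<noteq> {}" "P = apt_pt I x"
    by (metis PGL_cases compact_apartmentE)
  ultimately show "\<exists>u\<in>U0_hat v. \<exists>n\<in>monomial_group. \<exists>h\<in>P_stab v P. g = u \<otimes>\<^bsub>PGL\<^esub> n \<otimes>\<^bsub>PGL\<^esub> h"
    using ex_monomial_decomposition[OF v, of A I x] U_stab_subset_U0_hat[OF v] U_stab_subset_P_stab[OF v, of P]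
    by blast
qed (fact nu_closed[OF v] nu_one[OF v] nu_mult[OF v] subgroup_P_stab[OF v] P_stab_conj[OF v])+

lemma topspace_PGL_topology: "topspace (PGL_topology v) = carrier PGL"
  unfolding PGL_topology_def by (rule topspace_final_topology) auto

locale compactified_building =
  gluing "PGL :: ('k::field, 'n::finite) pgl monoid" monomial_group "nu v" compact_apartment "P_stab v" "U0_hat v"
  for v :: "'k::field \<Rightarrow> ereal" +
  assumes valuation: "normalized_valuation v"
begin

text \<open>The parameter \<open>v\<close> of the locale does not determine the type \<open>'n\<close>; these abbreviations do.\<close>

abbreviation U0 :: "('k, 'n) pgl set" where
  "U0 \<equiv> U0_hat v"

abbreviation X :: "('k, 'n) chart_pt set set" where
  "X \<equiv> building v"

abbreviation Xbar :: "('k, 'n) chart_pt set set" where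
  "Xbar \<equiv> compact_building v"

abbreviation X_top :: "('k, 'n) chart_pt set topology" where
  "X_top \<equiv> building_topology v"

abbreviation Xbar_top :: "('k, 'n) chart_pt set topology" where
  "Xbar_top \<equiv> compact_building_topology v"

section \<open>The relations defining X and X-bar as restrictions of one relation\<close>

lemma glue_rel_eq:
  "D \<subseteq> carrier PGL \<times> compact_apartment \<Longrightarrow> glue_rel v D = glue \<inter> D \<times> D"
  unfolding glue_rel_def glue_def by blast

lemma compact_rel_eq:
  "compact_rel v = glue \<inter> (U0 \<times> compact_apartment) \<times> (U0 \<times> compact_apartment)"
  by (rule glue_rel_eq) (use K_carrier in blast)

lemma building_rel_eq:
  "building_rel v = glue \<inter> (carrier PGL \<times> apartment) \<times> (carrier PGL \<times> apartment)"
  by (rule glue_rel_eq) (use apartment_subset_compact_apartment in blast)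

lemma glue_apartment_iff:
  "((g, x), (h, y)) \<in> glue \<Longrightarrow> x \<in> apartment \<longleftrightarrow> y \<in> apartment"
  using nu_in_apartment_iff[OF valuation] unfolding glue_iff by blast

lemma glue_refl: "g \<in> carrier PGL \<Longrightarrow> x \<in> compact_apartment \<Longrightarrow> ((g, x), (g, x)) \<in> glue"
  using equiv_glue unfolding equiv_def refl_on_def by blast

lemma compact_class_eq:
  "u \<in> U0 \<Longrightarrow> x \<in> compact_apartment \<Longrightarrow> compact_class v (u, x) = glue_class (u, x)"
  by (simp add: compact_class_def compact_rel_eq glue_class_restrict)

text \<open>No boundary point is glued to a point over the apartment, so restricting the relation
  does not shrink the class.\<close>

lemma building_class_eq:
  assumes "g \<in> carrier PGL" "x \<in> apartment"
  shows "building_class v (g, x) = glue `` {(g, x)}"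
proof -
  have "h \<in> carrier PGL" "y \<in> apartment" if "((g, x), (h, y)) \<in> glue" for h y
    using that assms glue_apartment_iff[OF that] by (auto simp: glue_iff)
  then show ?thesis
    using assms unfolding building_class_def building_rel_eq by fast
qed

lemma building_class_eq_iff:
  assumes "g \<in> carrier PGL" "x \<in> apartment" "h \<in> carrier PGL" "y \<in> apartment"
  shows "building_class v (g, x) = building_class v (h, y) \<longleftrightarrow> ((g, x), (h, y)) \<in> glue"
proof -
  have "(g, x) \<in> carrier PGL \<times> compact_apartment" "(h, y) \<in> carrier PGL \<times> compact_apartment"
    using assms apartment_subset_compact_apartment by blast+
  then show ?thesis
    using assms eq_equiv_class_iff[OF equiv_glue] by (simp add: building_class_eq)
qed

lemma building_class_in_building:
  "g \<in> carrier PGL \<Longrightarrow> x \<in> apartment \<Longrightarrow> building_class v (g, x) \<in> X"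
  unfolding building_def building_class_def by (rule quotientI) simp

text \<open>A decomposition of g replaces (g, x) by (u, nu(n)x), which still lies over the
  apartment.\<close>

lemma buildingE:
  assumes "c \<in> X"
  obtains u x where "u \<in> U0" "x \<in> apartment" "c = building_class v (u, x)"
proof -
  obtain g x where gx: "g \<in> carrier PGL" "x \<in> apartment" "c = building_class v (g, x)"
    using assms unfolding building_def building_class_def by (auto elim!: quotientE)
  then have x: "x \<in> compact_apartment" using apartment_subset_compact_apartment by blast
  obtain u n h where unh: "u \<in> U0" "n \<in> monomial_group" "h \<in> P_stab v x" "g = u \<otimes>\<^bsub>PGL\<^esub> n \<otimes>\<^bsub>PGL\<^esub> h"
    using decomposition[OF gx(1) x] by blast
  have u: "u \<in> carrier PGL" using unh K_carrier by blast
  have "nu v n x \<in> apartment" using nu_in_apartment_iff[OF valuation unh(2) x] gx by blast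
  moreover have "((g, x), (u, nu v n x)) \<in> glue" using glueI[OF u unh(2) x unh(3)] unh(4) by simp
  ultimately show thesis
    using that[OF unh(1)] gx u by (simp add: building_class_eq_iff)
qed

text \<open>By transitivity the restricted relation does not lead out of a full class, and by
  reflexivity it reaches the whole trace. Having this for every g in G, not just in U_0^, is what
  compatibility with the action uses.\<close>

lemma building_incl_class:
  assumes "g \<in> carrier PGL" "x \<in> apartment"
  shows "building_incl v (building_class v (g, x)) = glue_class (g, x)"
proof -
  have "building_incl v (building_class v (g, x)) =
      (glue \<inter> (U0 \<times> compact_apartment) \<times> (U0 \<times> compact_apartment)) `` (glue `` {(g, x)})"
    using assms by (simp add: building_incl_def compact_rel_eq building_class_eq)
  also have "\<dots> = glue_class (g, x)"
    using equiv_glue glue_refl K_carrier unfolding glue_class_def equiv_def trans_def by blast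
  finally show ?thesis .
qed

lemma building_incl_compact_class:
  assumes "u \<in> U0" "x \<in> apartment"
  shows "building_incl v (building_class v (u, x)) = compact_class v (u, x)"
proof -
  have "u \<in> carrier PGL" "x \<in> compact_apartment"
    using assms K_carrier apartment_subset_compact_apartment by blast+
  then show ?thesis
    using assms by (simp add: building_incl_class compact_class_eq)
qed

lemma inj_on_building_incl: "inj_on (building_incl v) X"
proof (rule inj_onI)
  fix c d assume "c \<in> X" "d \<in> X" and eq: "building_incl v c = building_incl v d"
  then obtain u x u' x' where c: "u \<in> U0" "x \<in> apartment" "c = building_class v (u, x)"
    and d: "u' \<in> U0" "x' \<in> apartment" "d = building_class v (u', x')"
    by (meson buildingE)
  have "u \<in> carrier PGL" "u' \<in> carrier PGL" "x \<in> compact_apartment" "x' \<in> compact_apartment"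
    using c d K_carrier apartment_subset_compact_apartment by blast+
  then show "c = d"
    using eq c d by (simp add: building_incl_class building_class_eq_iff glue_class_eq_iff)
qed

text \<open>Left multiplication by g preserves \<open>glue\<close>; that the image is the entire
  class is seen by multiplying with the inverse of g.\<close>

lemma building_act_class:
  fixes g a :: "('k, 'n) pgl"
  assumes "g \<in> carrier PGL" "a \<in> carrier PGL" "x \<in> apartment"
  shows "building_act g (building_class v (a, x)) = building_class v (g \<otimes>\<^bsub>PGL\<^esub> a, x)"
proof -
  have "(\<lambda>(h, x). (g \<otimes>\<^bsub>PGL\<^esub> h, x)) ` (glue `` {(a, x)}) = glue `` {(g \<otimes>\<^bsub>PGL\<^esub> a, x)}" (is "?f ` ?A = ?B")
  proof
    show "?f ` ?A \<subseteq> ?B" using glue_left_mult assms by auto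
    show "?B \<subseteq> ?f ` ?A"
    proof
      fix b assume "b \<in> ?B"
      moreover obtain h y where b: "b = (h, y)" by (cases b)
      ultimately have h: "((g \<otimes>\<^bsub>PGL\<^esub> a, x), (h, y)) \<in> glue" "h \<in> carrier PGL" by (auto simp: glue_iff)
      then have eq: "h = g \<otimes>\<^bsub>PGL\<^esub> (inv\<^bsub>PGL\<^esub> g \<otimes>\<^bsub>PGL\<^esub> h)"
        using assms by (simp add: mult_inv_cancel)
      then have "((a, x), (inv\<^bsub>PGL\<^esub> g \<otimes>\<^bsub>PGL\<^esub> h, y)) \<in> glue"
        using h assms glue_left_mult_iff[of g a "inv\<^bsub>PGL\<^esub> g \<otimes>\<^bsub>PGL\<^esub> h" x y] by simp
      then show "b \<in> ?f ` ?A"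
        using b eq by (intro image_eqI[of _ _ "(inv\<^bsub>PGL\<^esub> g \<otimes>\<^bsub>PGL\<^esub> h, y)"]) auto
    qed
  qed
  then show ?thesis
    using assms by (simp add: building_act_def building_class_eq)
qed

subsection \<open>Topology\<close>

abbreviation chart_topology :: "('k, 'n) chart_pt topology" where
  "chart_topology \<equiv> prod_topology (subtopology (PGL_topology v) U0) compact_apartment_topology"

lemma topspace_subtopology_U0: "topspace (subtopology (PGL_topology v) U0) = U0"
  using K_carrier by (simp add: topspace_PGL_topology Int_absorb1)

lemma topspace_chart_topology: "topspace chart_topology = U0 \<times> compact_apartment"
  by (simp only: topspace_prod_topology topspace_subtopology_U0 topspace_compact_apartment_topology)

lemma openin_chart_apartment: "openin chart_topology (U0 \<times> apartment)"
proof -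
  have "openin (subtopology (PGL_topology v) U0) U0"
    using openin_topspace[of "subtopology (PGL_topology v) U0"] unfolding topspace_subtopology_U0 .
  then show ?thesis
    by (simp add: openin_prod_Times_iff openin_compact_apartment_apartment)
qed

text \<open>Together with \<open>openin_chart_apartment\<close> this lets openness in X be tested in
  the chart of X-bar.\<close>

lemma building_chart_topology:
  "prod_topology (subtopology (PGL_topology v) U0) apartment_topology =
    subtopology chart_topology (U0 \<times> apartment)"
  unfolding apartment_topology_eq_subtopology prod_topology_subtopology(2) topspace_subtopology_U0 ..

lemma openin_building_iff:
  "openin X_top S \<longleftrightarrow> S \<subseteq> X \<and>
    openin chart_topology {a \<in> U0 \<times> apartment. building_class v a \<in> S}"
proof -
  have top: "topspace (subtopology chart_topology (U0 \<times> apartment)) = U0 \<times> apartment"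
    using apartment_subset_compact_apartment unfolding topspace_subtopology topspace_chart_topology by blast
  have "{a \<in> U0 \<times> apartment. building_class v a \<in> S} \<subseteq> U0 \<times> apartment"
    by blast
  then show ?thesis
    unfolding building_topology_def openin_final_topology building_chart_topology top
      openin_open_subtopology[OF openin_chart_apartment] by blast
qed

lemma openin_compact_building_iff:
  "openin Xbar_top S \<longleftrightarrow> S \<subseteq> Xbar \<and>
    openin chart_topology {a \<in> U0 \<times> compact_apartment. compact_class v a \<in> S}"
  unfolding compact_building_topology_def openin_final_topology topspace_chart_topology ..

lemma compact_class_in_compact_building:
  "a \<in> U0 \<times> compact_apartment \<Longrightarrow> compact_class v a \<in> Xbar"
  unfolding compact_building_def compact_class_def by (rule quotientI)

lemma compact_buildingE:
  assumes "c \<in> Xbar"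
  obtains u x where "u \<in> U0" "x \<in> compact_apartment" "c = compact_class v (u, x)"
  using assms unfolding compact_building_def compact_class_def by (auto elim!: quotientE)

lemma topspace_building: "topspace X_top = X"
  unfolding building_topology_def
proof (rule topspace_final_topology)
  show "building_class v ` topspace (prod_topology (subtopology (PGL_topology v) U0) apartment_topology) \<subseteq> X"
    using K_carrier building_class_in_building
    unfolding topspace_prod_topology topspace_subtopology_U0 topspace_apartment_topology by blast
qed

lemma topspace_compact_building: "topspace Xbar_top = Xbar"
  unfolding compact_building_topology_def
  by (rule topspace_final_topology) (use compact_class_in_compact_building topspace_chart_topology in blast)

lemma continuous_building_incl:
  "continuous_map X_top Xbar_top (building_incl v)"
  unfolding continuous_map_def topspace_building topspace_compact_building
proof (intro conjI allI impI)
  show "building_incl v \<in> X \<rightarrow> Xbar"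
  proof
    fix c assume "c \<in> X"
    then obtain u x where "u \<in> U0" "x \<in> apartment" "c = building_class v (u, x)"
      by (rule buildingE)
    then show "building_incl v c \<in> Xbar"
      using compact_class_in_compact_building[of "(u, x)"] apartment_subset_compact_apartment
      by (auto simp: building_incl_compact_class)
  qed
  fix S assume S: "openin Xbar_top S"
  have "{a \<in> U0 \<times> apartment. building_class v a \<in> {c \<in> X. building_incl v c \<in> S}} =
      {a \<in> U0 \<times> compact_apartment. compact_class v a \<in> S} \<inter> (U0 \<times> apartment)"
    (is "?L = ?R")
  proof (intro subset_antisym subsetI)
    fix a assume a: "a \<in> ?L"
    then obtain u x where ux: "a = (u, x)" "u \<in> U0" "x \<in> apartment" by blast
    then have "x \<in> compact_apartment" using apartment_subset_compact_apartment by blast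
    with a ux show "a \<in> ?R" by (simp add: building_incl_compact_class)
  next
    fix a assume a: "a \<in> ?R"
    then obtain u x where ux: "a = (u, x)" "u \<in> U0" "x \<in> apartment" by blast
    then have "building_class v (u, x) \<in> X" using building_class_in_building K_carrier by blast
    with a ux show "a \<in> ?L" by (simp add: building_incl_compact_class)
  qed
  then show "openin X_top {c \<in> X. building_incl v c \<in> S}"
    using S openin_chart_apartment unfolding openin_building_iff openin_compact_building_iff
    by (simp add: openin_Int)
qed

text \<open>The part of the chart over the apartment is saturated, so no boundary point maps into
  the image of S, and the preimage of that image is exactly the preimage of S.\<close>

lemma open_building_incl:
  "open_map X_top Xbar_top (building_incl v)"
  unfolding open_map_def
proof (intro allI impI)
  fix S assume S: "openin X_top S"
  then have sub: "S \<subseteq> X" by (simp add: openin_building_iff)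
  have "{a \<in> U0 \<times> compact_apartment. compact_class v a \<in> building_incl v ` S} =
      {a \<in> U0 \<times> apartment. building_class v a \<in> S}" (is "?L = ?R")
  proof
    show "?R \<subseteq> ?L"
      using building_incl_compact_class apartment_subset_compact_apartment by fastforce
    show "?L \<subseteq> ?R"
    proof
      fix a assume "a \<in> ?L"
      moreover obtain u x where a: "a = (u, x)" by (cases a)
      ultimately obtain c where u: "u \<in> U0" "x \<in> compact_apartment"
        and c: "c \<in> S" "compact_class v (u, x) = building_incl v c" by auto
      obtain u' x' where u': "u' \<in> U0" "x' \<in> apartment" "c = building_class v (u', x')"
        using c(1) sub by (meson buildingE subsetD)
      have carrier: "u \<in> carrier PGL" "u' \<in> carrier PGL" "x' \<in> compact_apartment"
        using u u' K_carrier apartment_subset_compact_apartment by blast+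
      then have "((u, x), (u', x')) \<in> glue"
        using c(2) u u' by (simp add: building_incl_compact_class compact_class_eq glue_class_eq_iff)
      moreover from this have "x \<in> apartment"
        using glue_apartment_iff u'(2) by blast
      ultimately have "building_class v (u, x) = c"
        using carrier u' by (simp add: building_class_eq_iff)
      then show "a \<in> ?R"
        using a c(1) u(1) \<open>x \<in> apartment\<close> by simp
    qed
  qed
  moreover have "building_incl v ` S \<subseteq> Xbar"
    using continuous_map_image_subset_topspace[OF continuous_building_incl] sub
    unfolding topspace_building topspace_compact_building by blast
  ultimately show "openin Xbar_top (building_incl v ` S)"
    using S by (simp add: openin_building_iff openin_compact_building_iff)
qed

lemma embedding_building_incl:
  "embedding_map X_top Xbar_top (building_incl v)"
  using continuous_building_incl open_building_incl inj_on_building_incl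
  by (intro injective_open_imp_embedding_map) (simp_all add: topspace_building)

lemma openin_building_incl_image:
  "openin Xbar_top (building_incl v ` X)"
  using open_building_incl openin_topspace[of "X_top"]
  unfolding open_map_def topspace_building by blast

lemma dense_building:
  "Xbar_top closure_of (building_incl v ` X) = Xbar"
proof
  show "Xbar_top closure_of (building_incl v ` X) \<subseteq> Xbar"
    using closure_of_subset_topspace topspace_compact_building by metis
  show "Xbar \<subseteq> Xbar_top closure_of (building_incl v ` X)"
  proof
    fix c assume c: "c \<in> Xbar"
    then obtain u x where ux: "u \<in> U0" "x \<in> compact_apartment" "c = compact_class v (u, x)"
      by (rule compact_buildingE)
    have "\<exists>d. d \<in> building_incl v ` X \<and> d \<in> S"
      if S: "c \<in> S" "openin Xbar_top S" for S
    proof -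
      define S' where "S' = {a \<in> U0 \<times> compact_apartment. compact_class v a \<in> S}"
      have S': "openin chart_topology S'" "(u, x) \<in> S'"
        using S ux by (auto simp: S'_def openin_compact_building_iff)
      \<comment> \<open>Inside a box around (u, x) it is enough to move the second factor into the
        apartment and to keep u.\<close>
      obtain V W where VW: "openin compact_apartment_topology W" "u \<in> V" "x \<in> W" "V \<times> W \<subseteq> S'"
        using S'(1)[unfolded openin_prod_topology_alt, rule_format, OF S'(2)] by blast
      obtain y where "y \<in> W" "y \<in> apartment"
        using corner_meets_apartment[OF VW(1)] VW(3) by blast
      then have "compact_class v (u, y) \<in> S"
        using VW(2,4) unfolding S'_def by blast
      moreover have "building_class v (u, y) \<in> X"
        "compact_class v (u, y) = building_incl v (building_class v (u, y))"
        using \<open>y \<in> apartment\<close> ux(1) building_class_in_building K_carrier building_incl_compact_class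
        by (blast, simp)
      ultimately show ?thesis by auto
    qed
    then show "c \<in> Xbar_top closure_of (building_incl v ` X)"
      using c by (auto simp: in_closure_of topspace_compact_building)
  qed
qed

subsection \<open>The action\<close>

lemma ex_action:
  "\<exists>act. group_action PGL Xbar act \<and>
    (\<forall>g\<in>carrier PGL. \<forall>u'\<in>U0. \<forall>x\<in>compact_apartment.
      (\<exists>u\<in>U0. \<exists>n\<in>monomial_group. \<exists>h\<in>P_stab v x.
         g \<otimes>\<^bsub>PGL\<^esub> u' = u \<otimes>\<^bsub>PGL\<^esub> n \<otimes>\<^bsub>PGL\<^esub> h) \<and>
      (\<forall>u\<in>U0. \<forall>n\<in>monomial_group. \<forall>h\<in>P_stab v x.
         g \<otimes>\<^bsub>PGL\<^esub> u' = u \<otimes>\<^bsub>PGL\<^esub> n \<otimes>\<^bsub>PGL\<^esub> h \<longrightarrow>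
         act g (compact_class v (u', x)) = compact_class v (u, nu v n x))) \<and>
    (\<forall>g\<in>carrier PGL. \<forall>c\<in>X. building_incl v (building_act g c) = act g (building_incl v c))"
proof -
  obtain act where act: "group_action PGL Xbar act"
    "\<And>g a x. \<lbrakk>g \<in> carrier PGL; a \<in> carrier PGL; x \<in> compact_apartment\<rbrakk> \<Longrightarrow>
      act g (glue_class (a, x)) = glue_class (g \<otimes>\<^bsub>PGL\<^esub> a, x)"
    using ex_glue_action unfolding compact_building_def compact_rel_eq by blast
  show ?thesis
  proof (intro exI[of _ act] conjI ballI impI)
    fix g u' :: "('k, 'n) pgl" and x :: "'n apt_point"
    assume g: "g \<in> carrier PGL" and u': "u' \<in> U0" and x: "x \<in> compact_apartment"
    have u'c: "u' \<in> carrier PGL" using u' K_carrier by blast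
    show "\<exists>u\<in>U0. \<exists>n\<in>monomial_group. \<exists>h\<in>P_stab v x. g \<otimes>\<^bsub>PGL\<^esub> u' = u \<otimes>\<^bsub>PGL\<^esub> n \<otimes>\<^bsub>PGL\<^esub> h"
      using decomposition[OF _ x] g u'c by simp
    fix u n h assume u: "u \<in> U0" and n: "n \<in> monomial_group" and h: "h \<in> P_stab v x"
      and eq: "g \<otimes>\<^bsub>PGL\<^esub> u' = u \<otimes>\<^bsub>PGL\<^esub> n \<otimes>\<^bsub>PGL\<^esub> h"
    \<comment> \<open>Every decomposition rewrites the same point (g u', x), so the value cannot
      depend on the one chosen.\<close>
    have "act g (compact_class v (u', x)) = glue_class (u \<otimes>\<^bsub>PGL\<^esub> n \<otimes>\<^bsub>PGL\<^esub> h, x)"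
      using act(2)[OF g u'c x] u' x eq by (simp add: compact_class_eq)
    also have "\<dots> = glue_class (u, nu v n x)"
      using u K_carrier by (intro glue_class_decomposition n x h) blast
    finally show "act g (compact_class v (u', x)) = compact_class v (u, nu v n x)"
      using u nu_closed[OF n x] by (simp add: compact_class_eq)
  next
    fix g :: "('k, 'n) pgl" and c assume g: "g \<in> carrier PGL" and "c \<in> X"
    then obtain u x where c: "u \<in> U0" "x \<in> apartment" "c = building_class v (u, x)"
      by (meson buildingE)
    then have "u \<in> carrier PGL" "x \<in> compact_apartment"
      using K_carrier apartment_subset_compact_apartment by blast+
    then show "building_incl v (building_act g c) = act g (building_incl v c)"
      using g c act(2) by (simp add: building_act_class building_incl_class)
  qed (rule act(1))
qed

end

lemma compactified_buildingI:
  "normalized_valuation v \<Longrightarrow> compactified_building TYPE('n::finite) v"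
  by (simp add: compactified_building_def compactified_building_axioms_def gluing_PGL)

text \<open>Well-definedness of the action is expressed by quantifying over all decompositions of g
  u'. The first clause pins \<open>building_incl\<close> down as the map induced by the inclusion,
  and \<open>embedding_map\<close> says that X carries the subspace topology.\<close>

theorem mainTheorem1:
  fixes p :: nat and v :: "'k::field_char_0 \<Rightarrow> ereal"
  assumes "finite_extension_of_Qp p v"
  shows "let
      G = PGL :: ('k, 'n::finite) pgl monoid;
      X = building v :: ('k, 'n) chart_pt set set;
      Xbar = compact_building v :: ('k, 'n) chart_pt set set;
      j = building_incl v :: ('k, 'n) chart_pt set \<Rightarrow> ('k, 'n) chart_pt set
    in
      (\<forall>u\<in>U0_hat v. \<forall>x\<in>apartment. j (building_class v (u, x)) = compact_class v (u, x)) \<and>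
      inj_on j X \<and>
      embedding_map (building_topology v) (compact_building_topology v) j \<and>
      openin (compact_building_topology v) (j ` X) \<and>
      compact_building_topology v closure_of (j ` X) = Xbar \<and>
      (\<exists>act. group_action G Xbar act \<and>
         (\<forall>g\<in>carrier G. \<forall>u'\<in>U0_hat v. \<forall>x\<in>compact_apartment.
            (\<exists>u\<in>U0_hat v. \<exists>n\<in>monomial_group. \<exists>h\<in>P_stab v x.
               g \<otimes>\<^bsub>G\<^esub> u' = u \<otimes>\<^bsub>G\<^esub> n \<otimes>\<^bsub>G\<^esub> h) \<and>
            (\<forall>u\<in>U0_hat v. \<forall>n\<in>monomial_group. \<forall>h\<in>P_stab v x.
               g \<otimes>\<^bsub>G\<^esub> u' = u \<otimes>\<^bsub>G\<^esub> n \<otimes>\<^bsub>G\<^esub> h \<longrightarrow>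
               act g (compact_class v (u', x)) = compact_class v (u, nu v n x))) \<and>
         (\<forall>g\<in>carrier G. \<forall>c\<in>X. j (building_act g c) = act g (j c)))"
proof -
  have C: "compactified_building TYPE('n) v"
    using assms by (intro compactified_buildingI) (simp add: finite_extension_of_Qp_def)
  show ?thesis
    unfolding Let_def
    by (intro conjI ballI compactified_building.building_incl_compact_class[OF C]
        compactified_building.inj_on_building_incl[OF C] compactified_building.embedding_building_incl[OF C]
        compactified_building.openin_building_incl_image[OF C] compactified_building.dense_building[OF C]
        compactified_building.ex_action[OF C])
qed

end
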